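(* Let $\mathrm{Vir}$ be the Virasoro algebra over $\mathbb{C}$ with central element $z$, let $W=\mathrm{Vir}/\mathbb{C}z$ be the Witt algebra, and let $\chi\in \mathrm{Vir}^*$. The following are equivalent: (1) The Poisson core of $\chi$ is nontrivial: that is, $\mathrm{P}(\chi)\supsetneqq (z-\chi(z))$. (2) $\chi(z)=0$ and the induced function $\overline{\chi}\in W^*$ is a linear combination of functions of the form $$f\partial_t\mapsto \alpha_0 f(x)+\alpha_1 f'(x)+\dots+\alpha_n f^{(n)}(x),$$ where $x\in\mathbb{C}^\times$, $n\geq 0$ and $\alpha_0,\dots,\alpha_n\in\mathbb{C}$. (3) The isotropy subalgebra $\mathrm{Vir}^\chi$ of $\chi$ has finite codimension in $\mathrm{Vir}$.
   Context: $W=\mathbb{C}[t,t^{-1}]\partial_t$ is the Lie algebra of algebraic vector fields on $\mathbb{C}^\times$, with $[f\partial_t,g\partial_t]=(fg'-f'g)\partial_t$. $\mathrm{Vir}=\mathbb{C}[t,t^{-1}]\partial_t\oplus\mathbb{C}z$ with $z$ central and $[f\partial_t,g\partial_t]=(fg'-f'g)\partial_t+\mathrm{Res}_0(f'g''-g'f'')z$, where $\mathrm{Res}_0$ is the coefficient of $t^{-1}$. For a Lie algebra $\mathfrak g$, the symmetric algebra $\mathrm{S}(\mathfrak g)$ is a Poisson algebra via the bracket extending $\{u,v\}=[u,v]$ for $u,v\in\mathfrak g$. A Poisson ideal is an ideal $I$ with $\{I,\mathrm{S}(\mathfrak g)\}\subseteq I$. For $\chi\in\mathfrak g^*$ let $\mathrm{ev}_\chi:\mathrm{S}(\mathfrak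 g)\to\mathbb{C}$ be the algebra homomorphism extending $\chi$ and $\mathfrak m_\chi=\ker \mathrm{ev}_\chi$. The Poisson core $\mathrm{P}(\chi)$ is the largest Poisson ideal contained in $\mathfrak m_\chi$. Here $(z-\chi(z))$ denotes the ideal of $\mathrm{S}(\mathrm{Vir})$ generated by $z-\chi(z)$. The isotropy subalgebra is $\mathfrak g^\chi=\{v\in\mathfrak g : \chi([v,w])=0 \text{ for all } w\in\mathfrak g\}$. *)

theory Defs
  imports Complex_Main "HOL-Library.Poly_Mapping" "HOL-Library.Product_Plus"
begin

section \<open>Laurent polynomials, the Witt algebra and the Virasoro algebra\<close>

text \<open>
  Laurent polynomials in \<open>t\<close> are finitely supported functions on the exponents; the product of
  the library instance is convolution, and \<open>single n c\<close> stands for \<open>c t^n\<close>.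
\<close>

type_synonym laurent = "int \<Rightarrow>\<^sub>0 complex"

definition laurent_deriv :: "laurent \<Rightarrow> laurent" where
  "laurent_deriv f =
     (\<Sum>n\<in>Poly_Mapping.keys f.
        Poly_Mapping.single (n - 1) (of_int n * Poly_Mapping.lookup f n))"

definition laurent_res :: "laurent \<Rightarrow> complex" where
  "laurent_res f = Poly_Mapping.lookup f (- 1)"

definition laurent_eval :: "laurent \<Rightarrow> complex \<Rightarrow> complex" where
  "laurent_eval f x = (\<Sum>n\<in>Poly_Mapping.keys f. Poly_Mapping.lookup f n * x powi n)"

text \<open>
  A vector field \<open>f \<partial>\<^sub>t\<close> is represented by its coefficient \<open>f\<close>, and \<open>f \<partial>\<^sub>t + a z\<close> by the pair \<open>(f, a)\<close>.
  Vector space structures are given by explicit scalar multiplications.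
\<close>

type_synonym witt = laurent

type_synonym vir = "witt \<times> complex"

definition witt_bracket :: "witt \<Rightarrow> witt \<Rightarrow> witt" where
  "witt_bracket f g = f * laurent_deriv g - laurent_deriv f * g"

definition witt_scale :: "complex \<Rightarrow> witt \<Rightarrow> witt" where
  "witt_scale c f = Poly_Mapping.map ((*) c) f"

definition vir_scale :: "complex \<Rightarrow> vir \<Rightarrow> vir" where
  "vir_scale c v = (witt_scale c (fst v), c * snd v)"

definition vir_bracket :: "vir \<Rightarrow> vir \<Rightarrow> vir" where
  "vir_bracket u v =
     (let f = fst u; g = fst v in
       (witt_bracket f g,
        laurent_res (laurent_deriv f * laurent_deriv (laurent_deriv g)
                   - laurent_deriv g * laurent_deriv (laurent_deriv f))))"

definition vir_z :: vir where
  "vir_z = (0, 1)"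

text \<open>Linear functionals on the Virasoro algebra (the full algebraic dual space).\<close>

definition vir_dual :: "(vir \<Rightarrow> complex) set" where
  "vir_dual = {\<chi>. Vector_Spaces.linear vir_scale (*) \<chi>}"

text \<open>
  The Witt algebra is the quotient of the Virasoro algebra by the line through \<open>z\<close>, with
  \<open>fst\<close> as the quotient map; see \<open>witt_functional_fst\<close> below.
\<close>

definition witt_functional :: "(vir \<Rightarrow> complex) \<Rightarrow> witt \<Rightarrow> complex" where
  "witt_functional \<chi> f = \<chi> (f, 0)"

definition local_functional :: "complex \<Rightarrow> nat \<Rightarrow> (nat \<Rightarrow> complex) \<Rightarrow> witt \<Rightarrow> complex" where
  "local_functional x n \<alpha> f = (\<Sum>i\<le>n. \<alpha> i * laurent_eval ((laurent_deriv ^^ i) f) x)"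

definition combination_of_local_functionals :: "(witt \<Rightarrow> complex) \<Rightarrow> bool" where
  "combination_of_local_functionals \<phi> \<longleftrightarrow>
     (\<exists>(k::nat) c \<psi>.
        (\<forall>j<k. \<exists>x n \<alpha>. x \<noteq> 0 \<and> \<psi> j = local_functional x n \<alpha>) \<and>
        \<phi> = (\<lambda>f. \<Sum>j<k. c j * \<psi> j f))"

definition isotropy :: "(vir \<Rightarrow> complex) \<Rightarrow> vir set" where
  "isotropy \<chi> = {v. \<forall>w. \<chi> (vir_bracket v w) = 0}"

text \<open>
  The quotient by \<open>U\<close> is finite-dimensional: the cosets of finitely many vectors span it.
\<close>

definition vir_finite_codim :: "vir set \<Rightarrow> bool" where
  "vir_finite_codim U \<longleftrightarrow>
     (\<exists>B. finite B \<and> (\<forall>v. \<exists>b\<in>module.span vir_scale B. v - b \<in> U))"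


section \<open>The symmetric algebra of the Virasoro algebra\<close>

text \<open>
  The symmetric algebra is realised as the polynomial ring over the basis consisting of the
  \<open>t^n \<partial>\<^sub>t\<close> (index \<open>T n\<close>) and \<open>z\<close> (index \<open>Z\<close>). The universal property, and the fact that the
  bracket below is the unique biderivation extending the Lie bracket, are proved in the next section.
\<close>

datatype vir_index = T int | Z

type_synonym vir_monom = "vir_index \<Rightarrow>\<^sub>0 nat"

type_synonym sym_vir = "vir_monom \<Rightarrow>\<^sub>0 complex"

fun vir_basis :: "vir_index \<Rightarrow> vir" where
  "vir_basis (T n) = (Poly_Mapping.single n 1, 0)"
| "vir_basis Z = vir_z"

definition sym_const :: "complex \<Rightarrow> sym_vir" where
  "sym_const c = Poly_Mapping.single 0 c"

definition sym_var :: "vir_index \<Rightarrow> sym_vir" where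
  "sym_var i = Poly_Mapping.single (Poly_Mapping.single i 1) 1"

text \<open>The canonical linear embedding of the Virasoro algebra.\<close>

definition sym_incl :: "vir \<Rightarrow> sym_vir" where
  "sym_incl v =
     (\<Sum>n\<in>Poly_Mapping.keys (fst v). sym_const (Poly_Mapping.lookup (fst v) n) * sym_var (T n))
     + sym_const (snd v) * sym_var Z"

definition sym_indets :: "sym_vir \<Rightarrow> vir_index set" where
  "sym_indets p = (\<Union>m\<in>Poly_Mapping.keys p. Poly_Mapping.keys m)"

definition sym_pderiv :: "vir_index \<Rightarrow> sym_vir \<Rightarrow> sym_vir" where
  "sym_pderiv i p =
     (\<Sum>m\<in>Poly_Mapping.keys p.
        Poly_Mapping.single (m - Poly_Mapping.single i 1)
          (Poly_Mapping.lookup p m * of_nat (Poly_Mapping.lookup m i)))"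

definition sym_bracket :: "sym_vir \<Rightarrow> sym_vir \<Rightarrow> sym_vir" where
  "sym_bracket p q =
     (\<Sum>i\<in>sym_indets p. \<Sum>j\<in>sym_indets q.
        sym_pderiv i p * sym_pderiv j q * sym_incl (vir_bracket (vir_basis i) (vir_basis j)))"

text \<open>
  Substitution of ring elements \<open>y i\<close> for the variables, with coefficients mapped by \<open>h\<close>.
\<close>

definition sym_subst ::
  "(complex \<Rightarrow> 'r::comm_ring_1) \<Rightarrow> (vir_index \<Rightarrow> 'r) \<Rightarrow> sym_vir \<Rightarrow> 'r" where
  "sym_subst h y p =
     (\<Sum>m\<in>Poly_Mapping.keys p.
        h (Poly_Mapping.lookup p m) * (\<Prod>i\<in>Poly_Mapping.keys m. y i ^ Poly_Mapping.lookup m i))"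

definition sym_ev :: "(vir \<Rightarrow> complex) \<Rightarrow> sym_vir \<Rightarrow> complex" where
  "sym_ev \<chi> = sym_subst (\<lambda>c. c) (\<lambda>i. \<chi> (vir_basis i))"

text \<open>Ideals of a commutative ring are its submodules as a module over itself.\<close>

definition is_ideal :: "'r::comm_ring_1 set \<Rightarrow> bool" where
  "is_ideal = module.subspace (*)"

definition ideal_gen :: "'r::comm_ring_1 set \<Rightarrow> 'r set" where
  "ideal_gen = module.span (*)"

definition poisson_ideal :: "sym_vir set \<Rightarrow> bool" where
  "poisson_ideal I \<longleftrightarrow> is_ideal I \<and> (\<forall>p\<in>I. \<forall>q. sym_bracket p q \<in> I)"

definition ev_kernel :: "(vir \<Rightarrow> complex) \<Rightarrow> sym_vir set" where
  "ev_kernel \<chi> = {p. sym_ev \<chi> p = 0}"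

definition poisson_core :: "(vir \<Rightarrow> complex) \<Rightarrow> sym_vir set" where
  "poisson_core \<chi> = (GREATEST I. poisson_ideal I \<and> I \<subseteq> ev_kernel \<chi>)"


section \<open>Basic facts justifying the definitions\<close>

subsection \<open>Laurent polynomials\<close>

lemma poly_mapping_add_induct [case_names zero single add]:
  assumes "P 0" and "\<And>k c. P (Poly_Mapping.single k c)"
    and "\<And>p q. P p \<Longrightarrow> P q \<Longrightarrow> P (p + q)"
  shows "P (p :: 'k \<Rightarrow>\<^sub>0 'c::comm_monoid_add)"
proof (induction p rule: update_induct)
  case const
  show ?case by (rule assms(1))
next
  case (update f a b)
  have "Poly_Mapping.update a b f = Poly_Mapping.single a b + f"
    using update(1)
    by (intro poly_mapping_eqI)
      (auto simp: lookup_update lookup_add lookup_single when_def in_keys_iff)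
  then show ?case using assms update by simp
qed

lemma lookup_laurent_deriv:
  "Poly_Mapping.lookup (laurent_deriv f) n = of_int (n + 1) * Poly_Mapping.lookup f (n + 1)"
proof -
  have "Poly_Mapping.lookup (laurent_deriv f) n =
     (\<Sum>k\<in>Poly_Mapping.keys f. if k = n + 1 then of_int k * Poly_Mapping.lookup f k else 0)"
    unfolding laurent_deriv_def lookup_sum
    by (rule sum.cong) (auto simp: lookup_single when_def)
  also have "\<dots> = of_int (n + 1) * Poly_Mapping.lookup f (n + 1)"
    by (subst sum.delta) (auto simp: in_keys_iff)
  finally show ?thesis .
qed

lemma laurent_deriv_add: "laurent_deriv (f + g) = laurent_deriv f + laurent_deriv g"
  by (rule poly_mapping_eqI) (simp add: lookup_laurent_deriv lookup_add algebra_simps)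

lemma laurent_deriv_diff: "laurent_deriv (f - g) = laurent_deriv f - laurent_deriv g"
  by (rule poly_mapping_eqI) (simp add: lookup_laurent_deriv lookup_minus algebra_simps)

lemma laurent_deriv_zero [simp]: "laurent_deriv 0 = 0"
  by (simp add: laurent_deriv_def)

lemma laurent_deriv_single:
  "laurent_deriv (Poly_Mapping.single n c) = Poly_Mapping.single (n - 1) (of_int n * c)"
  by (rule poly_mapping_eqI) (auto simp: lookup_laurent_deriv lookup_single when_def)

lemma laurent_deriv_mult: "laurent_deriv (f * g) = f * laurent_deriv g + laurent_deriv f * g"
proof (induction f rule: poly_mapping_add_induct)
  case zero
  show ?case by simp
next
  case (single m c)
  show ?case
  proof (induction g rule: poly_mapping_add_induct)
    case zero
    show ?case by simp
  next
    case (single n d)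
    show ?case
      by (simp add: mult_single laurent_deriv_single single_add [symmetric] algebra_simps)
  next
    case (add p q)
    then show ?case by (simp add: laurent_deriv_add algebra_simps)
  qed
next
  case (add p q)
  then show ?case by (simp add: laurent_deriv_add algebra_simps)
qed

lemma laurent_res_add: "laurent_res (f + g) = laurent_res f + laurent_res g"
  by (simp add: laurent_res_def lookup_add)

lemma laurent_res_diff: "laurent_res (f - g) = laurent_res f - laurent_res g"
  by (simp add: laurent_res_def lookup_minus)

lemma laurent_res_zero [simp]: "laurent_res 0 = 0"
  by (simp add: laurent_res_def)

lemma laurent_res_deriv [simp]: "laurent_res (laurent_deriv f) = 0"
  by (simp add: laurent_res_def lookup_laurent_deriv)

lemma laurent_eval_superset:
  assumes "finite A" "Poly_Mapping.keys f \<subseteq> A"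
  shows "laurent_eval f x = (\<Sum>n\<in>A. Poly_Mapping.lookup f n * x powi n)"
  unfolding laurent_eval_def using assms
  by (intro sum.mono_neutral_left) (auto simp: in_keys_iff)

lemma laurent_eval_add: "laurent_eval (f + g) x = laurent_eval f x + laurent_eval g x"
  unfolding laurent_eval_def
  by (rule setsum_keys_plus_distrib) (simp_all add: algebra_simps)

lemma laurent_eval_mult:
  assumes "x \<noteq> 0"
  shows "laurent_eval (f * g) x = laurent_eval f x * laurent_eval g x"
proof (induction f rule: poly_mapping_add_induct)
  case zero
  show ?case by (simp add: laurent_eval_def)
next
  case (single m c)
  show ?case
  proof (induction g rule: poly_mapping_add_induct)
    case zero
    show ?case by (simp add: laurent_eval_def)
  next
    case (single n d)
    show ?case using assms by (simp add: mult_single laurent_eval_def power_int_add)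
  next
    case (add p q)
    then show ?case by (simp add: laurent_eval_add algebra_simps)
  qed
next
  case (add p q)
  then show ?case by (simp add: laurent_eval_add algebra_simps)
qed

text \<open>Formal derivatives evaluate to analytic ones.\<close>

lemma laurent_eval_deriv:
  assumes "x \<noteq> 0"
  shows "(laurent_eval f has_field_derivative laurent_eval (laurent_deriv f) x) (at x)"
proof (induction f rule: poly_mapping_add_induct)
  case zero
  have "laurent_eval 0 = (\<lambda>_. 0)" by (simp add: laurent_eval_def fun_eq_iff)
  then show ?case by (simp add: laurent_eval_def)
next
  case (single n c)
  have "laurent_eval (Poly_Mapping.single n c) = (\<lambda>x. c * x powi n)"
    by (auto simp: laurent_eval_def fun_eq_iff)
  moreover have "((\<lambda>x. c * x powi n) has_field_derivative c * (of_int n * x powi (n - 1))) (at x)"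
    using assms by (auto intro!: derivative_eq_intros)
  moreover have "laurent_eval (laurent_deriv (Poly_Mapping.single n c)) x
      = c * (of_int n * x powi (n - 1))"
    by (auto simp: laurent_eval_def laurent_deriv_single)
  ultimately show ?case by simp
next
  case (add p q)
  have "laurent_eval (p + q) = (\<lambda>x. laurent_eval p x + laurent_eval q x)"
    by (simp add: laurent_eval_add fun_eq_iff)
  then show ?case
    using DERIV_add [OF add] by (simp add: laurent_deriv_add laurent_eval_add)
qed


subsection \<open>The Virasoro algebra\<close>

lemma witt_scale_eq: "witt_scale c f = Poly_Mapping.single 0 c * f"
  by (simp add: witt_scale_def mult_map_scale_conv_mult)

lemma lookup_witt_scale [simp]:
  "Poly_Mapping.lookup (witt_scale c f) n = c * Poly_Mapping.lookup f n"
  by (auto simp: witt_scale_def Poly_Mapping.map.rep_eq when_def)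

lemma laurent_deriv_scale: "laurent_deriv (witt_scale c f) = witt_scale c (laurent_deriv f)"
  by (rule poly_mapping_eqI) (simp add: lookup_laurent_deriv)

lemma laurent_res_scale: "laurent_res (witt_scale c f) = c * laurent_res f"
  by (simp add: laurent_res_def)

lemma vector_space_witt_scale: "vector_space witt_scale"
  by unfold_locales (auto intro!: poly_mapping_eqI simp: lookup_add algebra_simps)

lemma vector_space_vir_scale: "vector_space vir_scale"
proof -
  interpret vector_space witt_scale by (rule vector_space_witt_scale)
  show ?thesis
    by unfold_locales (auto simp: vir_scale_def prod_eq_iff algebra_simps)
qed

lemma vir_bracket_add_left: "vir_bracket (u + u') v = vir_bracket u v + vir_bracket u' v"
  by (simp add: vir_bracket_def Let_def witt_bracket_def prod_eq_iff laurent_deriv_add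
      laurent_res_add laurent_res_diff algebra_simps)

lemma vir_bracket_scale_left: "vir_bracket (vir_scale c u) v = vir_scale c (vir_bracket u v)"
proof -
  have "laurent_res (Poly_Mapping.single 0 c * p) = c * laurent_res p" for p
    using laurent_res_scale [of c p] by (simp add: witt_scale_eq)
  moreover have "laurent_deriv (Poly_Mapping.single 0 c * p) = Poly_Mapping.single 0 c * laurent_deriv p" for p
    using laurent_deriv_scale [of c p] by (simp add: witt_scale_eq)
  moreover have "laurent_res (p * (Poly_Mapping.single 0 c * q)) = c * laurent_res (p * q)" for p q
    using laurent_res_scale [of c "p * q"] by (simp add: witt_scale_eq mult.left_commute)
  ultimately show ?thesis
    by (simp add: vir_bracket_def vir_scale_def Let_def witt_bracket_def prod_eq_iff witt_scale_eq
      laurent_res_diff right_diff_distrib mult.assoc mult.left_commute)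
qed

lemma vir_bracket_antisym: "vir_bracket v u = - vir_bracket u v"
  by (simp add: vir_bracket_def Let_def witt_bracket_def prod_eq_iff laurent_res_diff mult.commute)

lemma vir_bracket_self: "vir_bracket v v = 0"
  by (simp add: vir_bracket_def Let_def witt_bracket_def prod_eq_iff mult.commute)

lemma vir_bracket_add_right: "vir_bracket u (v + v') = vir_bracket u v + vir_bracket u v'"
  by (metis vir_bracket_antisym vir_bracket_add_left minus_add_distrib)

lemma vir_bracket_z: "vir_bracket vir_z v = 0"
  by (simp add: vir_bracket_def Let_def witt_bracket_def vir_z_def zero_prod_def)

lemma vir_bracket_jacobi:
  "vir_bracket u (vir_bracket v w) + vir_bracket v (vir_bracket w u)
     + vir_bracket w (vir_bracket u v) = 0"
proof -
  let ?D = laurent_deriv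
  define f g h where "f = fst u" "g = fst v" "h = fst w"
  have 1: "witt_bracket f (witt_bracket g h) + witt_bracket g (witt_bracket h f)
      + witt_bracket h (witt_bracket f g) = 0"
    by (simp add: witt_bracket_def laurent_deriv_diff laurent_deriv_mult algebra_simps)
  let ?c = "\<lambda>f g. laurent_res (?D f * ?D (?D g) - ?D g * ?D (?D f))"
  have c: "?c f g = 2 * laurent_res (?D f * ?D (?D g))" for f g
  proof -
    have "laurent_res (?D (?D f * ?D g)) = 0" by (rule laurent_res_deriv)
    then have "laurent_res (?D f * ?D (?D g)) + laurent_res (?D g * ?D (?D f)) = 0"
      by (simp add: laurent_deriv_mult laurent_res_add mult.commute)
    then show ?thesis
      by (simp add: laurent_res_diff add_eq_0_iff)
  qed
  have c': "?c f g = - 2 * laurent_res (?D (?D f) * ?D g)" for f g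
  proof -
    have "laurent_res (?D (?D f * ?D g)) = 0" by (rule laurent_res_deriv)
    then have "laurent_res (?D f * ?D (?D g)) = - laurent_res (?D (?D f) * ?D g)"
      by (simp add: laurent_deriv_mult laurent_res_add eq_neg_iff_add_eq_0)
    then show ?thesis using c [of f g] by simp
  qed
  have "?D (?D f) * ?D (witt_bracket g h) + ?D (?D g) * ?D (witt_bracket h f)
      + ?D (?D h) * ?D (witt_bracket f g) = 0"
    by (simp add: witt_bracket_def laurent_deriv_diff laurent_deriv_mult algebra_simps)
  then have "laurent_res (?D (?D f) * ?D (witt_bracket g h))
      + laurent_res (?D (?D g) * ?D (witt_bracket h f))
      + laurent_res (?D (?D h) * ?D (witt_bracket f g)) = 0"
    by (metis laurent_res_add laurent_res_zero)
  then have 2: "?c f (witt_bracket g h) + ?c g (witt_bracket h f) + ?c h (witt_bracket f g) = 0"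
    unfolding c' by (simp only: distrib_left [symmetric] mult_zero_right)
  show ?thesis
    using 1 2 by (simp add: vir_bracket_def Let_def prod_eq_iff f_g_h_def)
qed

lemma witt_functional_fst:
  assumes "\<chi> \<in> vir_dual" "\<chi> vir_z = 0"
  shows "witt_functional \<chi> (fst v) = \<chi> v"
proof -
  interpret Vector_Spaces.linear vir_scale "(*)" \<chi>
    using assms(1) by (simp add: vir_dual_def)
  have "v = (fst v, 0) + vir_scale (snd v) vir_z"
    by (simp add: vir_scale_def vir_z_def prod_eq_iff witt_scale_eq)
  then have "\<chi> v = \<chi> (fst v, 0) + snd v * \<chi> vir_z"
    by (metis add scale)
  then show ?thesis by (simp add: witt_functional_def assms(2))
qed

lemma vir_induct [case_names single z add]:
  assumes "\<And>n c. P (vir_scale c (vir_basis (T n)))" and "\<And>c. P (vir_scale c vir_z)"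
    and add: "\<And>u v. P u \<Longrightarrow> P v \<Longrightarrow> P (u + v)"
  shows "P v"
proof -
  have s: "vir_scale c (vir_basis (T n)) = (Poly_Mapping.single n c, 0)"
     "vir_scale c vir_z = (0, c)" for c n
    by (auto simp: vir_scale_def vir_z_def witt_scale_eq mult_single)
  have "P (f, 0)" for f
  proof (induction f rule: poly_mapping_add_induct)
    case zero
    show ?case using assms(2) [of 0] by (simp add: s)
  next
    case (single k c)
    show ?case using assms(1) [of c k] by (simp only: s)
  next
    case (add p q)
    then show ?case using assms(3) [of "(p, 0)" "(q, 0)"] by simp
  qed
  then have "P ((fst v, 0) + (0, snd v))"
    using assms(2) [of "snd v"] by (intro add) (auto simp: s)
  then show ?thesis by simp
qed


subsection \<open>The universal property of the symmetric algebra\<close>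

lemma sym_const_hom:
  "sym_const 0 = 0" "sym_const 1 = 1"
  "sym_const (a + b) = sym_const a + sym_const b"
  "sym_const (a * b) = sym_const a * sym_const b"
  by (simp_all add: sym_const_def single_add mult_single)

lemma single_eq_prod_sym_var:
  "(Poly_Mapping.single m c :: sym_vir)
     = sym_const c * (\<Prod>i\<in>Poly_Mapping.keys m. sym_var i ^ Poly_Mapping.lookup m i)"
proof -
  have pow: "sym_var i ^ k = Poly_Mapping.single (Poly_Mapping.single i k) 1" for i k
    by (induction k) (simp_all add: sym_var_def mult_single single_add [symmetric])
  have "(\<Prod>i\<in>A. sym_var i ^ Poly_Mapping.lookup m i)
      = Poly_Mapping.single (\<Sum>i\<in>A. Poly_Mapping.single i (Poly_Mapping.lookup m i)) 1"
    if "finite A" for A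
    using that by induction (simp_all add: pow mult_single)
  moreover have "(\<Sum>i\<in>Poly_Mapping.keys m. Poly_Mapping.single i (Poly_Mapping.lookup m i)) = m"
  proof (rule poly_mapping_eqI)
    fix k
    show "Poly_Mapping.lookup (\<Sum>i\<in>Poly_Mapping.keys m.
        Poly_Mapping.single i (Poly_Mapping.lookup m i)) k = Poly_Mapping.lookup m k"
      by (simp add: lookup_sum lookup_single when_def in_keys_iff)
  qed
  ultimately show ?thesis by (simp add: sym_const_def mult_single)
qed

lemma sym_induct [case_names const var add mult]:
  assumes const: "\<And>c. P (sym_const c)" and var: "\<And>i. P (sym_var i)"
    and add: "\<And>p q. P p \<Longrightarrow> P q \<Longrightarrow> P (p + q)" and mult: "\<And>p q. P p \<Longrightarrow> P q \<Longrightarrow> P (p * q)"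
  shows "P p"
proof (induction p rule: poly_mapping_add_induct)
  case zero
  show ?case using const [of 0] by (simp add: sym_const_hom)
next
  case (single m c)
  have one: "P 1" using const [of 1] by (simp add: sym_const_hom)
  have pow: "P (sym_var i ^ k)" for i k
    by (induction k) (auto intro: one var mult)
  have "P (\<Prod>i\<in>A. sym_var i ^ Poly_Mapping.lookup m i)" if "finite A" for A
    using that by induction (auto intro: one pow mult)
  then show ?case unfolding single_eq_prod_sym_var by (auto intro: const mult)
next
  case (add p q)
  then show ?case by (rule assms(3))
qed

lemma sym_incl_add: "sym_incl (u + v) = sym_incl u + sym_incl v"
proof -
  have "(\<Sum>n\<in>Poly_Mapping.keys (f + g). sym_const (Poly_Mapping.lookup (f + g) n) * sym_var (T n))
     = (\<Sum>n\<in>Poly_Mapping.keys f. sym_const (Poly_Mapping.lookup f n) * sym_var (T n))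
     + (\<Sum>n\<in>Poly_Mapping.keys g. sym_const (Poly_Mapping.lookup g n) * sym_var (T n))" for f g
    by (rule setsum_keys_plus_distrib) (simp_all add: sym_const_hom algebra_simps)
  then show ?thesis by (simp add: sym_incl_def sym_const_hom algebra_simps)
qed

lemma sym_incl_scale_basis: "sym_incl (vir_scale c (vir_basis i)) = sym_const c * sym_var i"
  by (cases i) (simp_all add: sym_incl_def vir_scale_def vir_z_def witt_scale_eq mult_single sym_const_hom)

lemma sym_incl_basis: "sym_incl (vir_basis i) = sym_var i"
  by (cases i) (simp_all add: sym_incl_def vir_z_def sym_const_hom)

lemma sym_incl_scale: "sym_incl (vir_scale c v) = sym_const c * sym_incl v"
proof -
  interpret vector_space vir_scale by (rule vector_space_vir_scale)
  show ?thesis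
  proof (induction v rule: vir_induct)
    case (single n d)
    then show ?case
      by (simp only: scale_scale sym_incl_scale_basis) (simp add: sym_const_hom mult.assoc)
  next
    case (z d)
    then show ?case
      using sym_incl_scale_basis [of _ Z] by (simp add: sym_const_hom mult.assoc)
  next
    case (add u v)
    then show ?case by (simp add: scale_right_distrib sym_incl_add algebra_simps)
  qed
qed

definition coeff_hom :: "(complex \<Rightarrow> 'r::comm_ring_1) \<Rightarrow> bool" where
  "coeff_hom h \<longleftrightarrow> h 0 = 0 \<and> h 1 = 1 \<and>
     (\<forall>a b. h (a + b) = h a + h b) \<and> (\<forall>a b. h (a * b) = h a * h b)"

lemma sym_subst_add:
  assumes "coeff_hom h"
  shows "sym_subst h y (p + q) = sym_subst h y p + sym_subst h y q"
  unfolding sym_subst_def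
  by (rule setsum_keys_plus_distrib) (use assms in \<open>simp_all add: coeff_hom_def algebra_simps\<close>)

lemma sym_subst_const [simp]: "coeff_hom h \<Longrightarrow> sym_subst h y (sym_const c) = h c"
  by (simp add: sym_subst_def sym_const_def coeff_hom_def)

lemma sym_subst_var [simp]: "coeff_hom h \<Longrightarrow> sym_subst h y (sym_var i) = y i"
  by (simp add: sym_subst_def sym_var_def coeff_hom_def)

lemma sym_subst_mult:
  assumes h: "coeff_hom h"
  shows "sym_subst h y (p * q) = sym_subst h y p * sym_subst h y q"
proof (induction p rule: poly_mapping_add_induct)
  case zero
  show ?case by (simp add: sym_subst_def)
next
  case (single m c)
  show ?case
  proof (induction q rule: poly_mapping_add_induct)
    case zero
    show ?case by (simp add: sym_subst_def)
  next
    case (single n d)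
    let ?K = "Poly_Mapping.keys m \<union> Poly_Mapping.keys n"
    have e: "(\<Prod>i\<in>Poly_Mapping.keys k. y i ^ Poly_Mapping.lookup k i)
        = (\<Prod>i\<in>?K. y i ^ Poly_Mapping.lookup k i)" if "Poly_Mapping.keys k \<subseteq> ?K" for k
      using that by (intro prod.mono_neutral_left) (auto simp: in_keys_iff)
    have s: "sym_subst h y (Poly_Mapping.single k c) =
        h c * (\<Prod>i\<in>Poly_Mapping.keys k. y i ^ Poly_Mapping.lookup k i)" for k c
      using h by (simp add: sym_subst_def coeff_hom_def)
    have "(\<Prod>i\<in>Poly_Mapping.keys (m + n). y i ^ Poly_Mapping.lookup (m + n) i)
        = (\<Prod>i\<in>Poly_Mapping.keys m. y i ^ Poly_Mapping.lookup m i)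
          * (\<Prod>i\<in>Poly_Mapping.keys n. y i ^ Poly_Mapping.lookup n i)"
      unfolding e [OF keys_add] e [OF Un_upper1] e [OF Un_upper2]
      by (simp add: lookup_add power_add prod.distrib)
    then show ?case
      unfolding mult_single s using h by (simp add: coeff_hom_def mult_ac)
  next
    case (add p q)
    then show ?case by (simp add: sym_subst_add [OF h] algebra_simps)
  qed
next
  case (add p q)
  then show ?case by (simp add: sym_subst_add [OF h] algebra_simps)
qed

theorem sym_universal:
  fixes h :: "complex \<Rightarrow> 'r::comm_ring_1" and \<phi> :: "vir \<Rightarrow> 'r"
  assumes h: "coeff_hom h"
    and add: "\<And>u v. \<phi> (u + v) = \<phi> u + \<phi> v"
    and scale: "\<And>c v. \<phi> (vir_scale c v) = h c * \<phi> v"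
  shows "\<exists>!\<Phi>. (\<forall>p q. \<Phi> (p + q) = \<Phi> p + \<Phi> q) \<and> (\<forall>p q. \<Phi> (p * q) = \<Phi> p * \<Phi> q) \<and>
           (\<forall>c. \<Phi> (sym_const c) = h c) \<and> (\<forall>v. \<Phi> (sym_incl v) = \<phi> v)"
    (is "\<exists>!\<Phi>. ?P \<Phi>")
proof (rule ex1I)
  let ?S = "sym_subst h (\<lambda>i. \<phi> (vir_basis i))"
  have incl: "?S (sym_incl v) = \<phi> v" for v
  proof (induction v rule: vir_induct)
    case (single n c)
    show ?case
      by (simp only: sym_incl_scale_basis sym_subst_mult [OF h] scale
          sym_subst_const [OF h] sym_subst_var [OF h])
  next
    case (z c)
    have "?S (sym_incl (vir_scale c (vir_basis Z))) = \<phi> (vir_scale c (vir_basis Z))"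
      by (simp only: sym_incl_scale_basis sym_subst_mult [OF h] scale
          sym_subst_const [OF h] sym_subst_var [OF h])
    then show ?case by simp
  next
    case (add u v)
    then show ?case by (simp add: sym_incl_add sym_subst_add [OF h] assms(2))
  qed
  show "?P ?S"
    by (simp add: incl sym_subst_add [OF h] sym_subst_mult [OF h] sym_subst_const [OF h])
  fix \<Phi> assume \<Phi>: "?P \<Phi>"
  show "\<Phi> = ?S"
  proof
    fix p
    show "\<Phi> p = ?S p"
    proof (induction p rule: sym_induct)
      case (const c)
      show ?case using \<Phi> by (simp add: sym_subst_const [OF h])
    next
      case (var i)
      show ?case using \<Phi> incl by (metis sym_incl_basis)
    next
      case (add p q)
      then show ?case using \<Phi> by (simp add: sym_subst_add [OF h])
    next
      case (mult p q)
      then show ?case using \<Phi> by (simp add: sym_subst_mult [OF h])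
    qed
  qed
qed

lemma sym_ev_hom:
  "sym_ev \<chi> (p + q) = sym_ev \<chi> p + sym_ev \<chi> q"
  "sym_ev \<chi> (p * q) = sym_ev \<chi> p * sym_ev \<chi> q"
  "sym_ev \<chi> (sym_const c) = c"
  by (simp_all add: sym_ev_def sym_subst_add sym_subst_mult sym_subst_const coeff_hom_def)

lemma sym_ev_incl:
  assumes "\<chi> \<in> vir_dual"
  shows "sym_ev \<chi> (sym_incl v) = \<chi> v"
proof -
  interpret Vector_Spaces.linear vir_scale "(*)" \<chi>
    using assms by (simp add: vir_dual_def)
  have chi_add: "\<chi> (u + v) = \<chi> u + \<chi> v" for u v by (rule add)
  have b: "sym_ev \<chi> (sym_incl (vir_scale c (vir_basis i))) = \<chi> (vir_scale c (vir_basis i))" for c i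
    by (simp only: sym_incl_scale_basis sym_ev_hom scale)
      (simp add: sym_ev_def coeff_hom_def)
  show ?thesis
  proof (induction v rule: vir_induct)
    case (single n c)
    show ?case by (rule b)
  next
    case (z c)
    show ?case using b [of c Z] by simp
  next
    case (add u v)
    then show ?case by (simp add: sym_incl_add sym_ev_hom chi_add)
  qed
qed


subsection \<open>The Poisson bracket\<close>

lemma sym_pderiv_add: "sym_pderiv i (p + q) = sym_pderiv i p + sym_pderiv i q"
  unfolding sym_pderiv_def
  by (rule setsum_keys_plus_distrib) (simp_all add: single_add [symmetric] algebra_simps)

lemma sym_pderiv_single:
  "sym_pderiv i (Poly_Mapping.single m c) =
     Poly_Mapping.single (m - Poly_Mapping.single i 1) (c * of_nat (Poly_Mapping.lookup m i))"
  by (simp add: sym_pderiv_def)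

lemma sym_pderiv_const [simp]: "sym_pderiv i (sym_const c) = 0"
  by (simp add: sym_const_def sym_pderiv_single)

lemma sym_pderiv_var: "sym_pderiv i (sym_var j) = (if i = j then 1 else 0)"
  by (simp add: sym_var_def sym_pderiv_single lookup_single)

lemma sym_pderiv_mult: "sym_pderiv i (p * q) = p * sym_pderiv i q + sym_pderiv i p * q"
proof (induction p rule: poly_mapping_add_induct)
  case zero
  show ?case by (simp add: sym_pderiv_def)
next
  case (single m c)
  show ?case
  proof (induction q rule: poly_mapping_add_induct)
    case zero
    show ?case by (simp add: sym_pderiv_def)
  next
    case (single n d)
    have sub: "(k + l) - Poly_Mapping.single i 1 = (k - Poly_Mapping.single i 1) + l"
      if "Poly_Mapping.lookup k i \<noteq> 0" for k l :: vir_monom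
      using that by (intro poly_mapping_eqI)
        (auto simp: lookup_add lookup_minus lookup_single when_def)
    have "Poly_Mapping.single (m + n - Poly_Mapping.single i 1) (c * d * of_nat (Poly_Mapping.lookup m i))
        = Poly_Mapping.single (m - Poly_Mapping.single i 1 + n) (c * d * of_nat (Poly_Mapping.lookup m i))"
      using sub [of m n] by (cases "Poly_Mapping.lookup m i = 0") simp_all
    moreover have "Poly_Mapping.single (m + n - Poly_Mapping.single i 1) (c * d * of_nat (Poly_Mapping.lookup n i))
        = Poly_Mapping.single (m + (n - Poly_Mapping.single i 1)) (c * d * of_nat (Poly_Mapping.lookup n i))"
      using sub [of n m] by (cases "Poly_Mapping.lookup n i = 0") (simp_all add: add.commute)
    ultimately show ?case
      by (simp add: mult_single sym_pderiv_single lookup_add distrib_left single_add mult_ac add_ac)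
  next
    case (add p q)
    then show ?case by (simp add: sym_pderiv_add algebra_simps)
  qed
next
  case (add p q)
  then show ?case by (simp add: sym_pderiv_add algebra_simps)
qed

lemma finite_sym_indets [simp]: "finite (sym_indets p)"
  by (simp add: sym_indets_def)

lemma sym_pderiv_eq_0: "i \<notin> sym_indets p \<Longrightarrow> sym_pderiv i p = 0"
  unfolding sym_pderiv_def by (rule sum.neutral) (auto simp: sym_indets_def in_keys_iff)

lemma sym_bracket_superset:
  assumes "finite A" "sym_indets p \<subseteq> A" "finite B" "sym_indets q \<subseteq> B"
  shows "sym_bracket p q = (\<Sum>i\<in>A. \<Sum>j\<in>B.
    sym_pderiv i p * sym_pderiv j q * sym_incl (vir_bracket (vir_basis i) (vir_basis j)))"
proof -
  have "sym_bracket p q = (\<Sum>i\<in>sym_indets p. \<Sum>j\<in>B.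
    sym_pderiv i p * sym_pderiv j q * sym_incl (vir_bracket (vir_basis i) (vir_basis j)))"
    unfolding sym_bracket_def using assms
    by (intro sum.cong sum.mono_neutral_left) (auto simp: sym_pderiv_eq_0)
  also have "\<dots> = (\<Sum>i\<in>A. \<Sum>j\<in>B.
    sym_pderiv i p * sym_pderiv j q * sym_incl (vir_bracket (vir_basis i) (vir_basis j)))"
    using assms by (intro sum.mono_neutral_left) (auto simp: sym_pderiv_eq_0)
  finally show ?thesis .
qed

lemma sym_bracket_antisym: "sym_bracket q p = - sym_bracket p q"
proof -
  have neg: "sym_incl (- v) = - sym_incl v" for v
  proof -
    have "sym_incl 0 = 0" by (simp add: sym_incl_def sym_const_hom)
    then have "sym_incl v + sym_incl (- v) = 0" by (simp flip: sym_incl_add)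
    then show ?thesis by (rule minus_unique [symmetric])
  qed
  have "sym_bracket q p = (\<Sum>i\<in>sym_indets p. \<Sum>j\<in>sym_indets q.
     sym_pderiv j q * sym_pderiv i p * sym_incl (vir_bracket (vir_basis j) (vir_basis i)))"
    unfolding sym_bracket_def by (rule sum.swap)
  also have "\<dots> = - sym_bracket p q"
    unfolding sym_bracket_def sum_negf [symmetric]
    by (intro sum.cong refl) (subst vir_bracket_antisym, simp add: neg mult_ac)
  finally show ?thesis .
qed

lemma sym_bracket_add_left: "sym_bracket (p + p') q = sym_bracket p q + sym_bracket p' q"
proof -
  let ?A = "sym_indets p \<union> sym_indets p' \<union> sym_indets (p + p')"
  show ?thesis
    by (simp add: sym_bracket_superset [where A = ?A and B = "sym_indets q"] sym_pderiv_add
        distrib_right sum.distrib le_supI1 le_supI2)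
qed

lemma sym_bracket_mult_left:
  "sym_bracket (p * p') q = p * sym_bracket p' q + sym_bracket p q * p'"
proof -
  let ?A = "sym_indets p \<union> sym_indets p' \<union> sym_indets (p * p')"
  show ?thesis
    by (simp add: sym_bracket_superset [where A = ?A and B = "sym_indets q"] sym_pderiv_mult
        sum.distrib sum_distrib_left sum_distrib_right le_supI1 le_supI2 algebra_simps)
qed

lemma sym_bracket_const_left [simp]: "sym_bracket (sym_const c) q = 0"
  by (simp add: sym_bracket_def)

lemma sym_bracket_add_right: "sym_bracket p (q + q') = sym_bracket p q + sym_bracket p q'"
  by (metis sym_bracket_antisym sym_bracket_add_left minus_add_distrib)

lemma sym_bracket_mult_right:
  "sym_bracket p (q * q') = q * sym_bracket p q' + sym_bracket p q * q'"
proof -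
  have "sym_bracket p (q * q') = - sym_bracket (q * q') p" by (rule sym_bracket_antisym)
  also have "\<dots> = q * (- sym_bracket q' p) + (- sym_bracket q p) * q'"
    by (simp add: sym_bracket_mult_left)
  also have "\<dots> = q * sym_bracket p q' + sym_bracket p q * q'"
    by (simp only: sym_bracket_antisym [of p, symmetric])
  finally show ?thesis .
qed

lemma sym_bracket_const_right [simp]: "sym_bracket p (sym_const c) = 0"
  using sym_bracket_antisym [of p "sym_const c"] by simp

lemma sym_bracket_var:
  "sym_bracket (sym_var i) (sym_var j) = sym_incl (vir_bracket (vir_basis i) (vir_basis j))"
proof -
  have "sym_indets (sym_var i) = {i}" for i
    by (simp add: sym_indets_def sym_var_def)
  then show ?thesis by (simp add: sym_bracket_def sym_pderiv_var)
qed

lemma sym_bracket_incl: "sym_bracket (sym_incl u) (sym_incl v) = sym_incl (vir_bracket u v)"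
proof -
  have scale_right: "vir_bracket u (vir_scale c v) = vir_scale c (vir_bracket u v)" for c u v
  proof -
    interpret vector_space vir_scale by (rule vector_space_vir_scale)
    show ?thesis
      using vir_bracket_scale_left [of c v u] vir_bracket_antisym [of u] by simp
  qed
  have 1: "sym_bracket (sym_incl (vir_basis i)) (sym_incl v) = sym_incl (vir_bracket (vir_basis i) v)"
    for i v
  proof -
    have b: "sym_bracket (sym_incl (vir_basis i)) (sym_incl (vir_scale c (vir_basis j)))
        = sym_incl (vir_bracket (vir_basis i) (vir_scale c (vir_basis j)))" for c j
      by (simp only: sym_incl_scale sym_incl_basis scale_right sym_bracket_mult_right
          sym_bracket_var sym_bracket_const_right mult_zero_left add_0_right)
    show ?thesis
    proof (induction v rule: vir_induct)
      case (single n c)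
      show ?case by (rule b)
    next
      case (z c)
      show ?case using b [of c Z] by simp
    next
      case (add u v)
      then show ?case by (simp add: sym_incl_add vir_bracket_add_right sym_bracket_add_right)
    qed
  qed
  have b: "sym_bracket (sym_incl (vir_scale c (vir_basis j))) (sym_incl v)
        = sym_incl (vir_bracket (vir_scale c (vir_basis j)) v)" for c j
    by (simp only: sym_incl_scale vir_bracket_scale_left sym_bracket_mult_left 1
          sym_bracket_const_left mult_zero_left add_0_right)
  show ?thesis
  proof (induction u rule: vir_induct)
    case (single n c)
    show ?case by (rule b)
  next
    case (z c)
    show ?case using b [of c Z] by simp
  next
    case (add u v)
    then show ?case by (simp add: sym_incl_add vir_bracket_add_left sym_bracket_add_left)
  qed
qed

lemma sym_bracket_jacobi:
  "sym_bracket p (sym_bracket q r) + sym_bracket q (sym_bracket r p)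
     + sym_bracket r (sym_bracket p q) = 0" (is "?J p q r = 0")
proof -
  note bil = sym_bracket_add_left sym_bracket_add_right sym_bracket_mult_left sym_bracket_mult_right
  have zero: "sym_bracket 0 q = 0" "sym_bracket q 0 = 0" for q
    using sym_bracket_const_left [of 0 q] sym_bracket_const_right [of q 0]
    by (simp_all add: sym_const_hom)
  have neg: "sym_bracket p (- q) = - sym_bracket p q" for p q
    using sym_bracket_add_right [of p q "- q"] by (simp add: zero eq_neg_iff_add_eq_0 add.commute)
  have diff: "sym_bracket p (q - r) = sym_bracket p q - sym_bracket p r" for p q r
    using sym_bracket_add_right [of p q "- r"] by (simp add: neg)
  have cyc: "?J p q r = ?J q r p" for p q r by (simp add: add_ac)
  have add: "?J (p + p') q r = ?J p q r + ?J p' q r" for p p' q r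
    by (simp add: bil algebra_simps)
  have mult: "?J (p * p') q r = p * ?J p' q r + ?J p q r * p'" for p p' q r
    using sym_bracket_antisym [of p q] sym_bracket_antisym [of p' q]
      sym_bracket_antisym [of p r] sym_bracket_antisym [of p' r]
    by (simp add: bil neg diff algebra_simps)
  have const: "?J (sym_const c) q r = 0" for c q r
    by (simp add: zero)
  have step: "?J p q r = 0" if "\<And>i. ?J (sym_var i) q r = 0" for p q r
  proof (induction p rule: sym_induct)
    case (const c)
    show ?case by (rule \<open>?J (sym_const c) q r = 0\<close>)
  next
    case (var i)
    show ?case by (rule that)
  next
    case (add p q)
    then show ?case by (simp only: \<open>\<And>p p' q r. ?J (p + p') q r = ?J p q r + ?J p' q r\<close> add_0_right)
  next
    case (mult p q)
    then show ?case
      by (simp only: \<open>\<And>p p' q r. ?J (p * p') q r = p * ?J p' q r + ?J p q r * p'\<close>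
          add_0_right mult_zero_left mult_zero_right)
  qed
  have "?J (sym_var i) (sym_var j) (sym_var k) = 0" for i j k
    using vir_bracket_jacobi [of "vir_basis i" "vir_basis j" "vir_basis k"]
      sym_incl_scale [of 0 0]
    by (simp flip: sym_incl_basis sym_incl_add add: sym_bracket_incl)
      (simp add: sym_incl_def sym_const_hom)
  then show ?thesis by (metis cyc step)
qed

theorem sym_bracket_unique:
  assumes add: "\<And>p p' q. B (p + p') q = B p q + B p' q" "\<And>p q q'. B p (q + q') = B p q + B p q'"
    and leibniz: "\<And>p p' q. B (p * p') q = p * B p' q + B p q * p'"
      "\<And>p q q'. B p (q * q') = q * B p q' + B p q * q'"
    and const: "\<And>c q. B (sym_const c) q = 0" "\<And>c p. B p (sym_const c) = 0"
    and lie: "\<And>u v. B (sym_incl u) (sym_incl v) = sym_incl (vir_bracket u v)"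
  shows "B = sym_bracket"
proof (intro ext)
  fix p q
  have var: "B (sym_var i) q = sym_bracket (sym_var i) q" for i
  proof (induction q rule: sym_induct)
    case (var j)
    show ?case by (simp flip: sym_incl_basis add: assms(7) sym_bracket_incl)
  qed (simp_all add: assms(1-6) sym_bracket_add_right sym_bracket_mult_right)
  show "B p q = sym_bracket p q"
    by (induction p rule: sym_induct)
      (simp_all add: var assms(1-6) sym_bracket_add_left sym_bracket_mult_left)
qed


subsection \<open>The Poisson core\<close>

lemma module_times: "module ((*) :: 'r::comm_ring_1 \<Rightarrow> 'r \<Rightarrow> 'r)"
  by unfold_locales (simp_all add: algebra_simps)

lemma is_ideal_iff:
  "is_ideal I \<longleftrightarrow> 0 \<in> I \<and> (\<forall>p\<in>I. \<forall>q\<in>I. p + q \<in> I) \<and> (\<forall>c. \<forall>p\<in>I. c * p \<in> I)"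
  by (simp add: is_ideal_def module.subspace_def [OF module_times])

lemma ideal_gen_singleton: "ideal_gen {p} = {c * p | c. True}"
  by (auto simp: ideal_gen_def module.span_singleton [OF module_times])

theorem poisson_core_greatest:
  shows "poisson_ideal (poisson_core \<chi>)" (is ?A)
    and "poisson_core \<chi> \<subseteq> ev_kernel \<chi>" (is ?B)
    and "\<And>I. poisson_ideal I \<Longrightarrow> I \<subseteq> ev_kernel \<chi> \<Longrightarrow> I \<subseteq> poisson_core \<chi>"
proof -
  define P where "P I \<longleftrightarrow> poisson_ideal I \<and> I \<subseteq> ev_kernel \<chi>" for I
  have ev0: "sym_ev \<chi> 0 = 0"
    using sym_ev_hom(3) [of \<chi> 0] by (simp add: sym_const_hom)
  have br0: "sym_bracket 0 q = 0" for q
    using sym_bracket_const_left [of 0 q] by (simp add: sym_const_hom)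
  have P0: "P {0}"
    by (auto simp: P_def poisson_ideal_def is_ideal_iff ev_kernel_def ev0 br0)
  have P_sum: "P {a + b | a b. a \<in> I \<and> b \<in> J}" if "P I" "P J" for I J
  proof -
    have I: "is_ideal I" "\<And>p q. p \<in> I \<Longrightarrow> sym_bracket p q \<in> I" "\<And>p. p \<in> I \<Longrightarrow> sym_ev \<chi> p = 0"
      and J: "is_ideal J" "\<And>p q. p \<in> J \<Longrightarrow> sym_bracket p q \<in> J" "\<And>p. p \<in> J \<Longrightarrow> sym_ev \<chi> p = 0"
      using that by (auto simp: P_def poisson_ideal_def ev_kernel_def)
    have "is_ideal {a + b | a b. a \<in> I \<and> b \<in> J}"
      unfolding is_ideal_iff
    proof (intro conjI ballI allI)
      show "0 \<in> {a + b | a b. a \<in> I \<and> b \<in> J}"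
        using I(1) J(1) by (force simp: is_ideal_iff)
    next
      fix p q assume "p \<in> {a + b | a b. a \<in> I \<and> b \<in> J}" "q \<in> {a + b | a b. a \<in> I \<and> b \<in> J}"
      then obtain a b a' b' where "a \<in> I" "b \<in> J" "a' \<in> I" "b' \<in> J" "p = a + b" "q = a' + b'"
        by blast
      then have "p + q = (a + a') + (b + b')" "a + a' \<in> I" "b + b' \<in> J"
        using I(1) J(1) by (auto simp: is_ideal_iff add_ac)
      then show "p + q \<in> {a + b | a b. a \<in> I \<and> b \<in> J}" by blast
    next
      fix c p assume "p \<in> {a + b | a b. a \<in> I \<and> b \<in> J}"
      then obtain a b where "a \<in> I" "b \<in> J" "p = a + b" by blast
      then have "c * p = c * a + c * b" "c * a \<in> I" "c * b \<in> J"
        using I(1) J(1) by (auto simp: is_ideal_iff distrib_left)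
      then show "c * p \<in> {a + b | a b. a \<in> I \<and> b \<in> J}" by blast
    qed
    then show ?thesis
      using I(2,3) J(2,3)
      by (auto simp: P_def poisson_ideal_def ev_kernel_def sym_ev_hom sym_bracket_add_left) blast
  qed
  have P_union: "P (\<Union>{I. P I})"
  proof -
    have "p + q \<in> \<Union>{I. P I}" if "p \<in> I" "q \<in> J" "P I" "P J" for p q I J
      using P_sum [OF that(3,4)] that(1,2) by blast
    moreover have "c * p \<in> I" if "P I" "p \<in> I" for c p I
      using that by (auto simp: P_def poisson_ideal_def is_ideal_iff)
    ultimately have "is_ideal (\<Union>{I. P I})"
      using P0 unfolding is_ideal_iff by blast
    then show ?thesis
      by (auto simp: P_def poisson_ideal_def)
  qed
  have eq: "poisson_core \<chi> = \<Union>{I. P I}"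
    unfolding poisson_core_def P_def [symmetric]
    by (rule Greatest_equality) (use P_union in auto)
  have "P (poisson_core \<chi>)" unfolding eq by (rule P_union)
  then show ?A ?B by (simp_all add: P_def)
  show "I \<subseteq> poisson_core \<chi>" if "poisson_ideal I" "I \<subseteq> ev_kernel \<chi>" for I
    using that unfolding eq P_def by blast
qed

end

theory Submission
  imports Defs "HOL-Computational_Algebra.Fundamental_Theorem_Algebra" "Jordan_Normal_Form.Determinant"
begin

text \<open>
  Write \<open>L\<close> for the Laurent polynomials, \<open>c = \<chi>(z)\<close>, and \<open>\<phi>\<close> for the functional that \<open>\<chi>\<close> induces
  on \<open>L\<close>. All three conditions are compared with a fourth and a fifth one:

  \<^item> \<open>c = 0\<close>, and \<open>\<phi>\<close> vanishes on a nonzero ideal \<open>h L\<close>;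
  \<^item> the isotropy algebra contains vector fields of arbitrarily high degree
    (\<open>unbounded_isotropy\<close>).

  Functionals that vanish on \<open>h L\<close> are the combinations of local ones: over \<open>\<complex>\<close> the polynomial
  \<open>h\<close> splits into linear factors, and these can be removed one at a time
  (\<open>combination_annihilator\<close>, \<open>combination_if_annihilated\<close>). If \<open>\<phi>\<close> kills \<open>h L\<close> and \<open>c = 0\<close>, then
  \<open>h\<^sup>2 L\<close> lies in the isotropy algebra, which therefore has finite codimension
  (\<open>annihilator_finite_codim\<close>); and a subspace of finite codimension contains elements of
  arbitrarily high degree (\<open>finite_codim_unbounded_isotropy\<close>).

  The way back rests on the identity
  \<open>[f\<^sub>1, f\<^sub>2 g] - [f\<^sub>2, f\<^sub>1 g] = 2 (f\<^sub>1 f\<^sub>2' - f\<^sub>1' f\<^sub>2) g\<close> in the Witt algebra. For \<open>f\<^sub>1\<close> and \<open>f\<^sub>2\<close> in the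
  isotropy algebra \<open>\<chi>\<close> kills the left-hand side, so that \<open>\<phi>\<close> kills the ideal generated by
  \<open>f\<^sub>1 f\<^sub>2' - f\<^sub>1' f\<^sub>2\<close>, up to a correction proportional to \<open>c\<close>. Comparing the corrections for three
  elements of different high degrees forces \<open>c = 0\<close> (\<open>unbounded_isotropy_annihilator\<close>).

  It remains to include the Poisson core. The differential at \<open>\<chi>\<close> of an element \<open>F\<close> of the core
  is an element of the isotropy algebra. If all these differentials were zero modulo \<open>z\<close>, then the core
  together with the partial derivatives of its elements would generate a Poisson ideal on which
  evaluation at \<open>\<chi>\<close> vanishes; so the core would be stable under the partial derivatives
  along the \<open>t\<^sup>n \<partial>\<^sub>t\<close>, and Taylor expansion at \<open>\<chi>\<close> would put it inside \<open>(z - c)\<close>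
  (\<open>poisson_core_derivative_nonzero\<close>). So a nontrivial core contains some \<open>F\<close> with a nonzero
  differential, and the differentials of the brackets \<open>{F, t\<^sup>N \<partial>\<^sub>t}\<close> for large \<open>N\<close> are isotropy elements of
  unbounded degree (\<open>poisson_core_unbounded_isotropy\<close>). Conversely, an isotropy algebra of finite
  codimension means that the form \<open>\<chi>([u, v])\<close> has finite rank, so that its minors of some size vanish. As
  elements of the symmetric algebra these minors generate a Poisson ideal, by the Jacobi identity,
  and they are not all divisible by \<open>z\<close> (\<open>finite_codim_poisson_core\<close>).
\<close>

section \<open>Linear forms on Laurent polynomials and jets at a point\<close>

abbreviation tpow :: "int \<Rightarrow> laurent" where "tpow n \<equiv> Poly_Mapping.single n 1"

abbreviation lconst :: "complex \<Rightarrow> laurent" where "lconst c \<equiv> Poly_Mapping.single 0 c"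

definition linear_form :: "(laurent \<Rightarrow> complex) \<Rightarrow> bool" where
  "linear_form \<phi> \<longleftrightarrow> (\<forall>f g. \<phi> (f + g) = \<phi> f + \<phi> g) \<and> (\<forall>c f. \<phi> (lconst c * f) = c * \<phi> f)"

lemma linear_form_add: "linear_form \<phi> \<Longrightarrow> \<phi> (f + g) = \<phi> f + \<phi> g"
  and linear_form_scale: "linear_form \<phi> \<Longrightarrow> \<phi> (lconst c * f) = c * \<phi> f"
  by (simp_all add: linear_form_def)

lemma linear_form_0: "linear_form \<phi> \<Longrightarrow> \<phi> 0 = 0"
  using linear_form_add [of \<phi> 0 0] by simp

lemma linear_form_minus: "linear_form \<phi> \<Longrightarrow> \<phi> (- f) = - \<phi> f"
  using linear_form_add [of \<phi> f "- f"] by (simp add: linear_form_0 eq_neg_iff_add_eq_0 add.commute)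

lemma linear_form_diff: "linear_form \<phi> \<Longrightarrow> \<phi> (f - g) = \<phi> f - \<phi> g"
  using linear_form_add [of \<phi> f "- g"] by (simp add: linear_form_minus)

definition jet :: "complex \<Rightarrow> nat \<Rightarrow> laurent \<Rightarrow> complex" where
  "jet x i f = laurent_eval ((laurent_deriv ^^ i) f) x"

lemma laurent_eval_0 [simp]: "laurent_eval 0 x = 0"
  by (simp add: laurent_eval_def)

lemma laurent_eval_single [simp]: "laurent_eval (Poly_Mapping.single n c) x = c * x powi n"
  by (simp add: laurent_eval_def)

lemma laurent_eval_diff: "laurent_eval (f - g) x = laurent_eval f x - laurent_eval g x"
  using laurent_eval_add [of "f - g" g x] by simp

lemma iterated_deriv_add:
  "(laurent_deriv ^^ i) (f + g) = (laurent_deriv ^^ i) f + (laurent_deriv ^^ i) g"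
  by (induction i) (simp_all add: laurent_deriv_add)

lemma iterated_deriv_scale:
  "(laurent_deriv ^^ i) (lconst c * f) = lconst c * (laurent_deriv ^^ i) f"
  by (induction i) (simp_all add: laurent_deriv_scale [unfolded witt_scale_eq])

lemma linear_form_jet: "x \<noteq> 0 \<Longrightarrow> linear_form (jet x i)"
  by (simp add: linear_form_def jet_def iterated_deriv_add iterated_deriv_scale
      laurent_eval_add laurent_eval_mult)

text \<open>
  Multiplication by \<open>t - x\<close> lowers the order of a jet at \<open>x\<close> by one, by the Leibniz rule. Both
  directions of the description of local functionals by annihilating ideals come from this formula.
\<close>
lemma iterated_deriv_mult_linear_factor:
  "(laurent_deriv ^^ i) ((tpow 1 - lconst x) * f)
     = (tpow 1 - lconst x) * (laurent_deriv ^^ i) f + lconst (of_nat i) * (laurent_deriv ^^ (i - 1)) f"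
proof (induction i)
  case 0
  show ?case by simp
next
  case (Suc i)
  let ?r = "tpow 1 - lconst x"
  have d: "laurent_deriv ?r = 1"
    by (simp add: laurent_deriv_diff laurent_deriv_single)
  have "lconst (of_nat i) * laurent_deriv ((laurent_deriv ^^ (i - 1)) f) = lconst (of_nat i) * (laurent_deriv ^^ i) f"
    by (cases i) simp_all
  then have "laurent_deriv (lconst (of_nat i) * (laurent_deriv ^^ (i - 1)) f) = lconst (of_nat i) * (laurent_deriv ^^ i) f"
    by (simp only: laurent_deriv_scale [unfolded witt_scale_eq])
  then have "(laurent_deriv ^^ Suc i) (?r * f) = ?r * (laurent_deriv ^^ Suc i) f
      + (1 * (laurent_deriv ^^ i) f + lconst (of_nat i) * (laurent_deriv ^^ i) f)"
    by (simp only: funpow.simps o_apply Suc laurent_deriv_add laurent_deriv_mult d add.assoc)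
  also have "1 * (laurent_deriv ^^ i) f + lconst (of_nat i) * (laurent_deriv ^^ i) f
      = lconst (of_nat (Suc i)) * (laurent_deriv ^^ (Suc i - 1)) f"
    by (simp add: single_add algebra_simps)
  finally show ?case .
qed

lemma jet_mult_linear_factor:
  assumes "y \<noteq> 0"
  shows "jet y i ((tpow 1 - lconst x) * f) = (y - x) * jet y i f + of_nat i * jet y (i - 1) f"
  unfolding jet_def iterated_deriv_mult_linear_factor
  unfolding laurent_eval_add laurent_eval_mult [OF assms] laurent_eval_diff laurent_eval_single
  by simp

lemma sum_lessThan_add:
  "(\<Sum>j<m + n. f j) = (\<Sum>j<m. f j) + (\<Sum>j<n. f (m + j :: nat) :: 'a :: comm_monoid_add)"
  by (induction n) (simp_all add: add.assoc)

lemma combination_0: "combination_of_local_functionals (\<lambda>_. 0)"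
  unfolding combination_of_local_functionals_def by (rule exI [of _ 0]) simp

lemma combination_add:
  assumes "combination_of_local_functionals \<phi>" "combination_of_local_functionals \<psi>"
  shows "combination_of_local_functionals (\<lambda>f. \<phi> f + \<psi> f)"
proof -
  obtain k :: nat and c \<alpha> where \<alpha>: "\<forall>j<k. \<exists>x n a. x \<noteq> 0 \<and> \<alpha> j = local_functional x n a"
      "\<phi> = (\<lambda>f. \<Sum>j<k. c j * \<alpha> j f)"
    using assms(1) unfolding combination_of_local_functionals_def by blast
  obtain l :: nat and d \<beta> where \<beta>: "\<forall>j<l. \<exists>x n a. x \<noteq> 0 \<and> \<beta> j = local_functional x n a"
      "\<psi> = (\<lambda>f. \<Sum>j<l. d j * \<beta> j f)"
    using assms(2) unfolding combination_of_local_functionals_def by blast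
  let ?c = "\<lambda>j. if j < k then c j else d (j - k)" and ?\<gamma> = "\<lambda>j. if j < k then \<alpha> j else \<beta> (j - k)"
  have "\<forall>j<k + l. \<exists>x n a. x \<noteq> 0 \<and> ?\<gamma> j = local_functional x n a"
    using \<alpha>(1) \<beta>(1) by auto
  moreover have "(\<lambda>f. \<phi> f + \<psi> f) = (\<lambda>f. \<Sum>j<k + l. ?c j * ?\<gamma> j f)"
    unfolding \<alpha>(2) \<beta>(2) sum_lessThan_add by simp
  ultimately show ?thesis
    unfolding combination_of_local_functionals_def
    by (intro exI [of _ "k + l"] exI [of _ ?c] exI [of _ ?\<gamma>] conjI)
qed

lemma combination_jet:
  assumes "x \<noteq> 0"
  shows "combination_of_local_functionals (\<lambda>f. c * jet x i f)"
proof -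
  have "local_functional x i (\<lambda>j. if j = i then 1 else 0) = jet x i"
  proof
    fix f
    have "local_functional x i (\<lambda>j. if j = i then 1 else 0) f
        = (\<Sum>j\<le>i. if j = i then jet x j f else 0)"
      unfolding local_functional_def jet_def by (intro sum.cong) auto
    then show "local_functional x i (\<lambda>j. if j = i then 1 else 0) f = jet x i f" by simp
  qed
  then show ?thesis
    unfolding combination_of_local_functionals_def using assms
    by (intro exI [of _ 1] exI [of _ "\<lambda>_. c"] exI [of _ "\<lambda>_. jet x i"] conjI) (metis, simp)
qed

text \<open>
  A local functional is itself a sum of multiples of jets, so combinations can be built by adding
  one multiple of a jet at a time.
\<close>
lemma combination_induct [consumes 1, case_names zero add_jet]:
  assumes "combination_of_local_functionals \<phi>" and zero: "P (\<lambda>_. 0)"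
    and step: "\<And>x i c \<phi>. x \<noteq> 0 \<Longrightarrow> P \<phi> \<Longrightarrow> P (\<lambda>f. \<phi> f + c * jet x i f)"
  shows "P \<phi>"
proof -
  obtain k :: nat and c \<psi> where \<psi>: "\<forall>j<k. \<exists>x n a. x \<noteq> 0 \<and> \<psi> j = local_functional x n a"
      "\<phi> = (\<lambda>f. \<Sum>j<k. c j * \<psi> j f)"
    using assms(1) unfolding combination_of_local_functionals_def by blast
  have one: "P (\<lambda>f. \<phi> f + b * (\<Sum>i<n. a i * jet x i f))" if "P \<phi>" "x \<noteq> 0" for \<phi> a b x n
  proof (induction n)
    case 0
    show ?case using that by simp
  next
    case (Suc n)
    from step [OF \<open>x \<noteq> 0\<close> this, of "b * a n" n] show ?case
      by (simp add: algebra_simps)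
  qed
  have "P (\<lambda>f. \<Sum>j<m. c j * \<psi> j f)" if "m \<le> k" for m
    using that
  proof (induction m)
    case 0
    show ?case using zero by simp
  next
    case (Suc m)
    then obtain x n a where xna: "x \<noteq> 0" "\<psi> m = local_functional x n a"
      using \<psi>(1) by (meson Suc_le_lessD)
    have "\<psi> m f = (\<Sum>i<Suc n. a i * jet x i f)" for f
      by (simp only: xna(2) local_functional_def jet_def lessThan_Suc_atMost)
    then show ?case
      using one [OF Suc.IH xna(1), where b = "c m" and n = "Suc n" and a = a] Suc.prems by simp
  qed
  then show ?thesis unfolding \<psi>(2) by blast
qed

lemma linear_form_combination: "combination_of_local_functionals \<phi> \<Longrightarrow> linear_form \<phi>"
proof (induction rule: combination_induct)
  case zero
  show ?case by (simp add: linear_form_def)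
next
  case (add_jet x i c \<phi>)
  then show ?case
    using linear_form_jet [OF \<open>x \<noteq> 0\<close>, of i] unfolding linear_form_def
    by (simp only: distrib_left mult.left_commute add_ac simp_thms)
qed

lemma jet_power_linear_factor:
  assumes "x \<noteq> 0" "i < n"
  shows "jet x i ((tpow 1 - lconst x) ^ n * g) = 0"
  using assms(2)
proof (induction n arbitrary: i)
  case 0
  then show ?case by simp
next
  case (Suc n)
  have "jet x i ((tpow 1 - lconst x) ^ Suc n * g)
      = of_nat i * jet x (i - 1) ((tpow 1 - lconst x) ^ n * g)"
    using jet_mult_linear_factor [OF assms(1), of i x "(tpow 1 - lconst x) ^ n * g"]
    by (simp add: mult.assoc)
  also have "\<dots> = 0"
    using Suc by (cases i) auto
  finally show ?case .
qed

text \<open>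
  The \<open>i\<close>-th jet at \<open>x\<close> kills \<open>(t - x)\<^sup>i\<^sup>+\<^sup>1 L\<close>; the product of such powers over all jets involved is nonzero
  because the Laurent polynomials form a domain.
\<close>
lemma combination_annihilator:
  assumes "combination_of_local_functionals \<phi>"
  shows "\<exists>h. h \<noteq> 0 \<and> (\<forall>g. \<phi> (h * g) = 0)"
  using assms
proof (induction rule: combination_induct)
  case zero
  show ?case by (intro exI [of _ 1]) simp
next
  case (add_jet x i c \<phi>)
  then obtain h where h: "h \<noteq> 0" "\<And>g. \<phi> (h * g) = 0" by blast
  let ?p = "(tpow 1 - lconst x) ^ Suc i"
  have "Poly_Mapping.lookup (tpow 1 - lconst x) 1 = 1"
    by (simp add: lookup_minus lookup_single)
  then have "tpow 1 - lconst x \<noteq> 0" by auto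
  then have "?p * h \<noteq> 0" using h(1) by simp
  moreover have "\<phi> (?p * h * g) + c * jet x i (?p * h * g) = 0" for g
    using h(2) [of "?p * g"] jet_power_linear_factor [OF add_jet(1), of i "Suc i" "h * g"]
    by (simp only: mult.assoc mult.left_commute lessI mult_zero_right add_0_right)
  ultimately show ?case by blast
qed

text \<open>
  Precomposition with multiplication by \<open>t - x\<close> is onto the combinations of local functionals. A
  jet at \<open>x\<close> is obtained from the next higher jet at \<open>x\<close>. At \<open>y \<noteq> x\<close> the factor \<open>y - x\<close> is invertible,
  and the lower jet that remains is treated by induction on the order.
\<close>
lemma combination_divide:
  assumes "combination_of_local_functionals \<phi>" "x \<noteq> 0"
  shows "\<exists>\<psi>. combination_of_local_functionals \<psi> \<and> (\<forall>f. \<psi> ((tpow 1 - lconst x) * f) = \<phi> f)"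
proof -
  have jet_divide: "\<exists>\<psi>. combination_of_local_functionals \<psi> \<and>
      (\<forall>f. \<psi> ((tpow 1 - lconst x) * f) = c * jet y i f)" if y: "y \<noteq> 0" for y i c
  proof (cases "y = x")
    case True
    then show ?thesis
      using combination_jet [OF y, of "c / of_nat (Suc i)" "Suc i"]
        jet_mult_linear_factor [OF y, of "Suc i" x]
      by (intro exI [of _ "\<lambda>f. c / of_nat (Suc i) * jet y (Suc i) f"]) (simp del: of_nat_Suc)
  next
    case False
    show ?thesis
    proof (induction i arbitrary: c)
      case 0
      show ?case
        using combination_jet [OF y, of "c / (y - x)" 0] False
          jet_mult_linear_factor [OF y, of 0 x]
        by (intro exI [of _ "\<lambda>f. c / (y - x) * jet y 0 f"]) simp
    next
      case (Suc i)
      define d where "d = c / (y - x)"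
      obtain \<psi> where \<psi>: "combination_of_local_functionals \<psi>"
          "\<And>f. \<psi> ((tpow 1 - lconst x) * f) = (- d * of_nat (Suc i)) * jet y i f"
        using Suc.IH by blast
      have "d * (y - x) = c" using False by (simp add: d_def)
      then have "\<psi> ((tpow 1 - lconst x) * f) + d * jet y (Suc i) ((tpow 1 - lconst x) * f)
          = c * jet y (Suc i) f" for f
        unfolding \<psi>(2) jet_mult_linear_factor [OF y]
        by (simp only: diff_Suc_1 distrib_left mult.assoc [symmetric]) simp
      then show ?case
        using combination_add [OF \<psi>(1) combination_jet [OF y, of d "Suc i"]] by blast
    qed
  qed
  show ?thesis
    using assms(1)
  proof (induction rule: combination_induct)
    case zero
    show ?case using combination_0 by (intro exI [of _ "\<lambda>_. 0"]) simp
  next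
    case (add_jet y i c \<phi>)
    then obtain \<psi> where \<psi>: "combination_of_local_functionals \<psi>"
        "\<And>f. \<psi> ((tpow 1 - lconst x) * f) = \<phi> f" by blast
    obtain \<theta> where \<theta>: "combination_of_local_functionals \<theta>"
        "\<And>f. \<theta> ((tpow 1 - lconst x) * f) = c * jet y i f"
      using jet_divide [OF \<open>y \<noteq> 0\<close>] by blast
    show ?case
      using combination_add [OF \<psi>(1) \<theta>(1)] \<psi>(2) \<theta>(2)
      by (intro exI [of _ "\<lambda>f. \<psi> f + \<theta> f"]) simp
  qed
qed

section \<open>Functionals that vanish on a nonzero ideal\<close>

definition laurent_of_poly :: "complex poly \<Rightarrow> laurent" where
  "laurent_of_poly p = poly (map_poly lconst p) (tpow 1)"

lemma laurent_of_poly_0 [simp]: "laurent_of_poly 0 = 0"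
  by (simp add: laurent_of_poly_def)

lemma laurent_of_poly_pCons:
  "laurent_of_poly (pCons a p) = lconst a + tpow 1 * laurent_of_poly p"
  by (cases "a = 0 \<and> p = 0") (auto simp: laurent_of_poly_def map_poly_pCons)

lemma laurent_of_poly_add: "laurent_of_poly (p + q) = laurent_of_poly p + laurent_of_poly q"
  by (induction p q rule: poly_induct2) (simp_all add: laurent_of_poly_pCons single_add algebra_simps)

lemma laurent_of_poly_smult: "laurent_of_poly (Polynomial.smult c p) = lconst c * laurent_of_poly p"
  by (induction p) (simp_all add: laurent_of_poly_pCons mult_single algebra_simps)

lemma laurent_of_poly_linear_factor:
  "laurent_of_poly ([:- x, 1:] * q) = (tpow 1 - lconst x) * laurent_of_poly q"
proof -
  have "[:- x, 1:] * q = pCons 0 q + Polynomial.smult (- x) q" by simp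
  then show ?thesis
    by (simp only: laurent_of_poly_add laurent_of_poly_smult laurent_of_poly_pCons)
      (simp add: single_uminus algebra_simps)
qed

lemma laurent_as_poly:
  assumes "h \<noteq> 0"
  shows "\<exists>p k. p \<noteq> 0 \<and> laurent_of_poly p = tpow k * h"
proof -
  have "\<exists>p k. laurent_of_poly p = tpow k * h"
  proof (induction h rule: poly_mapping_add_induct)
    case zero
    show ?case by (intro exI [of _ 0]) simp
  next
    case (single k c)
    have "laurent_of_poly [:c:] = tpow (- k) * Poly_Mapping.single k c"
      by (simp add: laurent_of_poly_pCons mult_single)
    then show ?case by blast
  next
    case (add f g)
    then obtain p k q l where pq: "laurent_of_poly p = tpow k * f" "laurent_of_poly q = tpow l * g"
      by blast
    have shift: "laurent_of_poly (([:0, 1:] ^ n) * p) = tpow (int n) * laurent_of_poly p" for n p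
    proof (induction n)
      case (Suc n)
      have "laurent_of_poly ([:0, 1:] ^ Suc n * p) = tpow 1 * laurent_of_poly ([:0, 1:] ^ n * p)"
        by (simp add: laurent_of_poly_pCons)
      also have "\<dots> = tpow (int (Suc n)) * laurent_of_poly p"
        unfolding Suc.IH mult.assoc [symmetric] by (simp add: mult_single)
      finally show ?case .
    qed simp
    have up: "\<exists>p'. laurent_of_poly p' = tpow m * f" if "laurent_of_poly p = tpow k * f" "k \<le> m" for p f k m
    proof
      show "laurent_of_poly (([:0, 1:] ^ nat (m - k)) * p) = tpow m * f"
        unfolding shift that(1) mult.assoc [symmetric] using that(2) by (simp add: mult_single)
    qed
    obtain p' q' where "laurent_of_poly p' = tpow (max k l) * f" "laurent_of_poly q' = tpow (max k l) * g"
      using up [OF pq(1)] up [OF pq(2)] by (metis max.cobounded1 max.cobounded2)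
    then have "laurent_of_poly (p' + q') = tpow (max k l) * (f + g)"
      by (simp add: laurent_of_poly_add distrib_left)
    then show ?case by blast
  qed
  then obtain p k where pk: "laurent_of_poly p = tpow k * h" by blast
  have "tpow (- k) * (tpow k * h) = h"
    unfolding mult.assoc [symmetric] by (simp add: mult_single)
  then have "p \<noteq> 0" using pk assms by auto
  then show ?thesis using pk by blast
qed

lemma linear_factor_division:
  assumes "x \<noteq> 0"
  shows "\<exists>g a. f = (tpow 1 - lconst x) * g + lconst a"
proof (induction f rule: poly_mapping_add_induct)
  case zero
  show ?case by (intro exI [of _ 0]) simp
next
  case (single n c)
  have "\<exists>g a. tpow n = (tpow 1 - lconst x) * g + lconst a"
  proof (induction n rule: int_induct [where k = 0])
    case base
    show ?case by (rule exI [of _ 0], rule exI [of _ 1]) simp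
  next
    case (step1 n)
    then obtain g a where ga: "tpow n = (tpow 1 - lconst x) * g + lconst a" by blast
    have "tpow (n + 1) = (tpow 1 - lconst x) * tpow n + lconst x * tpow n"
      by (simp add: algebra_simps mult_single)
    also have "\<dots> = (tpow 1 - lconst x) * (tpow n + lconst x * g) + lconst (x * a)"
      by (subst (2) ga) (simp add: algebra_simps mult_single)
    finally show ?case by blast
  next
    case (step2 n)
    then obtain g a where ga: "tpow n = (tpow 1 - lconst x) * g + lconst a" by blast
    have "tpow (n - 1) = lconst (1 / x) * (tpow n - (tpow 1 - lconst x) * tpow (n - 1))"
      using assms by (simp add: algebra_simps mult_single)
    also have "\<dots> = (tpow 1 - lconst x) * (lconst (1 / x) * (g - tpow (n - 1))) + lconst (1 / x * a)"
      by (subst ga) (simp add: algebra_simps mult_single)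
    finally show ?case by blast
  qed
  then obtain g a where ga: "tpow n = (tpow 1 - lconst x) * g + lconst a" by blast
  have "Poly_Mapping.single n c = lconst c * tpow n" by (simp add: mult_single)
  also have "\<dots> = (tpow 1 - lconst x) * (lconst c * g) + lconst (c * a)"
    by (subst ga) (simp add: algebra_simps mult_single)
  finally show ?case by blast
next
  case (add f1 f2)
  then obtain g a h b where "f1 = (tpow 1 - lconst x) * g + lconst a" "f2 = (tpow 1 - lconst x) * h + lconst b"
    by blast
  then have "f1 + f2 = (tpow 1 - lconst x) * (g + h) + lconst (a + b)"
    by (simp only: single_add distrib_left add_ac)
  then show ?case by blast
qed

text \<open>
  Induction on the degree of a polynomial generator \<open>p\<close> of the ideal. If \<open>p = (t - x) q\<close>, then
  \<open>f \<mapsto> \<phi>((t - x) f)\<close> kills \<open>q L\<close>, so it is a combination of local functionals. It is also of the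
  form \<open>f \<mapsto> \<psi>((t - x) f)\<close> for such a combination \<open>\<psi>\<close>, and \<open>\<phi> - \<psi>\<close> vanishes on \<open>(t - x) L\<close>, which is the kernel of
  evaluation at \<open>x\<close>. A root \<open>x = 0\<close> contributes the unit \<open>t\<close>.
\<close>
lemma combination_if_annihilated:
  assumes "linear_form \<phi>" "h \<noteq> 0" "\<And>g. \<phi> (h * g) = 0"
  shows "combination_of_local_functionals \<phi>"
proof -
  have main: "combination_of_local_functionals \<phi>"
    if "linear_form \<phi>" "p \<noteq> 0" "\<And>g. \<phi> (laurent_of_poly p * g) = 0" for p \<phi>
    using that
  proof (induction "degree p" arbitrary: p \<phi>)
    case 0
    then obtain a where a: "p = [:a:]" "a \<noteq> 0"
      by (metis degree_eq_zeroE pCons_eq_0_iff)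
    have "\<phi> f = 0" for f
      using "0.prems"(3) [of "lconst (1 / a) * f"] a
      by (simp add: laurent_of_poly_pCons mult.assoc [symmetric] mult_single)
    then have "\<phi> = (\<lambda>_. 0)" by blast
    then show ?case using combination_0 by simp
  next
    case (Suc n)
    then obtain x where "poly p x = 0"
      using fundamental_theorem_of_algebra [of p] by (metis constant_degree nat.distinct(1))
    then obtain q where q: "p = [:- x, 1:] * q"
      using poly_eq_0_iff_dvd dvdE by blast
    then have q0: "q \<noteq> 0" using Suc.prems(2) by auto
    then have "degree p = degree [:- x, 1:] + degree q"
      unfolding q by (intro degree_mult_eq) auto
    then have n: "n = degree q" using Suc.hyps(2) by simp
    define r where "r = tpow 1 - lconst x"
    have p: "laurent_of_poly p = r * laurent_of_poly q"
      unfolding q r_def by (rule laurent_of_poly_linear_factor)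
    show ?case
    proof (cases "x = 0")
      case True
      have "\<phi> (laurent_of_poly q * g) = 0" for g
        using Suc.prems(3) [of "tpow (- 1) * g"] True unfolding p r_def
        by (simp add: mult_ac) (simp add: mult.assoc [symmetric] mult_single)
      then show ?thesis using Suc.hyps(1) [OF n Suc.prems(1) q0] by blast
    next
      case False
      have "linear_form (\<lambda>f. \<phi> (r * f))"
        using linear_form_add [OF Suc.prems(1)] linear_form_scale [OF Suc.prems(1)]
        unfolding linear_form_def by (metis distrib_left mult.left_commute)
      moreover have "\<phi> (r * (laurent_of_poly q * g)) = 0" for g
        using Suc.prems(3) [of g] by (simp add: p mult.assoc)
      ultimately have "combination_of_local_functionals (\<lambda>f. \<phi> (r * f))"
        using Suc.hyps(1) [OF n _ q0] by blast
      then obtain \<psi> where \<psi>: "combination_of_local_functionals \<psi>" "\<And>f. \<psi> (r * f) = \<phi> (r * f)"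
        using combination_divide [OF _ False] unfolding r_def by blast
      define c where "c = \<phi> 1 - \<psi> 1"
      have "\<phi> f = \<psi> f + c * jet x 0 f" for f
      proof -
        obtain g a where f: "f = r * g + lconst a"
          unfolding r_def using linear_factor_division [OF False] by blast
        have "jet x 0 f = a"
          using False by (simp add: f jet_def r_def laurent_eval_add laurent_eval_mult laurent_eval_diff)
        moreover have value_at: "\<theta> f = \<theta> (r * g) + a * \<theta> 1" if "linear_form \<theta>" for \<theta>
          unfolding f linear_form_add [OF that] using linear_form_scale [OF that, of a 1] by simp
        ultimately show ?thesis
          using value_at [OF Suc.prems(1)] value_at [OF linear_form_combination [OF \<psi>(1)]] \<psi>(2) [of g]
          by (simp add: c_def algebra_simps)
      qed
      then have "\<phi> = (\<lambda>f. \<psi> f + c * jet x 0 f)" by blast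
      then show ?thesis using combination_add [OF \<psi>(1) combination_jet [OF False]] by simp
    qed
  qed
  obtain p k where pk: "p \<noteq> 0" "laurent_of_poly p = tpow k * h"
    using laurent_as_poly [OF assms(2)] by blast
  have "\<phi> (laurent_of_poly p * g) = 0" for g
    using assms(3) [of "tpow k * g"] by (simp add: pk(2) mult_ac)
  then show ?thesis using main [OF assms(1) pk(1)] by blast
qed

section \<open>Degrees\<close>

text \<open>
  The coefficient \<open>a\<close> may be zero, so \<open>n\<close> is only a bound for the degree. In this form the
  coefficient is compatible with sums and derivatives even when leading terms cancel.
\<close>
definition top_coeff :: "laurent \<Rightarrow> int \<Rightarrow> complex \<Rightarrow> bool" where
  "top_coeff f n a \<longleftrightarrow> Poly_Mapping.lookup f n = a \<and> (\<forall>k>n. Poly_Mapping.lookup f k = 0)"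

lemma top_coeff_unique: "top_coeff f n a \<Longrightarrow> top_coeff f n b \<Longrightarrow> a = b"
  by (simp add: top_coeff_def)

lemma top_coeff_nonzero: "top_coeff f n a \<Longrightarrow> a \<noteq> 0 \<Longrightarrow> f \<noteq> 0"
  by (auto simp: top_coeff_def)

lemma top_coeff_single: "top_coeff (Poly_Mapping.single n a) n a"
  by (simp add: top_coeff_def lookup_single)

lemma top_coeff_add: "top_coeff f n a \<Longrightarrow> top_coeff g n b \<Longrightarrow> top_coeff (f + g) n (a + b)"
  by (simp add: top_coeff_def lookup_add)

lemma top_coeff_diff: "top_coeff f n a \<Longrightarrow> top_coeff g n b \<Longrightarrow> top_coeff (f - g) n (a - b)"
  by (simp add: top_coeff_def lookup_minus)

lemma top_coeff_deriv: "top_coeff f n a \<Longrightarrow> top_coeff (laurent_deriv f) (n - 1) (of_int n * a)"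
  by (simp add: top_coeff_def lookup_laurent_deriv)

lemma lookup_mult_beyond_degree:
  assumes "\<And>i. i \<ge> m \<Longrightarrow> Poly_Mapping.lookup f i = 0" "\<And>j. j > n \<Longrightarrow> Poly_Mapping.lookup g j = 0"
    and "k \<ge> m + n"
  shows "Poly_Mapping.lookup (f * g :: laurent) k = 0"
proof (rule ccontr)
  assume "Poly_Mapping.lookup (f * g) k \<noteq> 0"
  then have "k \<in> Poly_Mapping.keys (f * g)" by (simp add: in_keys_iff)
  then obtain i j where ij: "k = i + j" "i \<in> Poly_Mapping.keys f" "j \<in> Poly_Mapping.keys g"
    using keys_mult [of f g] by blast
  then have "\<not> i \<ge> m" "\<not> j > n" using assms(1,2) by (auto simp: in_keys_iff)
  then show False using ij(1) assms(3) by simp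
qed

lemma top_coeff_mult:
  assumes "top_coeff f m a" "top_coeff g n b"
  shows "top_coeff (f * g) (m + n) (a * b)"
proof -
  let ?a = "Poly_Mapping.single m a" and ?b = "Poly_Mapping.single n b"
  have lower: "Poly_Mapping.lookup (f - Poly_Mapping.single m a) i = 0"
    if "top_coeff f m a" "i \<ge> m" for f m a i
    using that by (cases "i = m") (simp_all add: top_coeff_def lookup_minus lookup_single)
  have "Poly_Mapping.lookup ((f - ?a) * g) k = 0" if "k \<ge> m + n" for k
    by (rule lookup_mult_beyond_degree [OF lower [OF assms(1)] _ that])
      (use assms(2) in \<open>auto simp: top_coeff_def\<close>)
  moreover have "Poly_Mapping.lookup ((g - ?b) * ?a) k = 0" if "k \<ge> m + n" for k
    by (rule lookup_mult_beyond_degree [where m = n and n = m, OF lower [OF assms(2)]])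
      (use that in \<open>auto simp: lookup_single\<close>)
  ultimately have "top_coeff ((f - ?a) * g + (g - ?b) * ?a) (m + n) 0"
    by (simp add: top_coeff_def lookup_add)
  from top_coeff_add [OF top_coeff_single [of "m + n" "a * b"] this]
  show ?thesis by (simp add: algebra_simps mult_single)
qed

lemma top_coeff_exists: "f \<noteq> 0 \<Longrightarrow> \<exists>n a. a \<noteq> 0 \<and> top_coeff f n a"
proof -
  assume "f \<noteq> 0"
  then have ne: "Poly_Mapping.keys f \<noteq> {}" by simp
  let ?n = "Max (Poly_Mapping.keys f)"
  have "?n \<in> Poly_Mapping.keys f" using ne by simp
  moreover have "k \<notin> Poly_Mapping.keys f" if "k > ?n" for k
  proof
    assume "k \<in> Poly_Mapping.keys f"
    then have "k \<le> ?n" by simp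
    then show False using that by simp
  qed
  ultimately show ?thesis
    by (intro exI [of _ ?n] exI [of _ "Poly_Mapping.lookup f ?n"]) (simp add: top_coeff_def in_keys_iff)
qed

section \<open>From isotropy elements of high degree to an annihilated ideal\<close>

abbreviation cocycle :: "laurent \<Rightarrow> laurent \<Rightarrow> complex" where
  "cocycle f g \<equiv> laurent_res (laurent_deriv f * laurent_deriv (laurent_deriv g)
                   - laurent_deriv g * laurent_deriv (laurent_deriv f))"

text \<open>Integration by parts: residues of derivatives vanish.\<close>
lemma cocycle_eq: "cocycle f g = 2 * laurent_res ((laurent_deriv ^^ 3) f * g)"
proof -
  let ?D = laurent_deriv
  have e: "(?D ^^ 3) f = ?D (?D (?D f))" by (simp add: numeral_3_eq_3)
  have "?D f * ?D (?D g) - ?D g * ?D (?D f)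
      = lconst 2 * (?D (?D (?D f)) * g) + ?D (?D f * ?D g) - lconst 2 * ?D (?D (?D f) * g)"
  proof -
    have "lconst 2 = 1 + 1" by (simp add: single_add [symmetric] flip: single_one)
    then show ?thesis by (simp add: laurent_deriv_mult algebra_simps)
  qed
  then show ?thesis
    using laurent_res_scale [of 2 "?D (?D (?D f)) * g"] laurent_res_scale [of 2 "?D (?D (?D f) * g)"]
    unfolding e by (simp only: laurent_res_add laurent_res_diff witt_scale_eq laurent_res_deriv) simp
qed

lemma vir_bracket_pair:
  "vir_bracket u v = (witt_bracket (fst u) (fst v), cocycle (fst u) (fst v))"
  by (simp add: vir_bracket_def Let_def)

lemma vir_dual_add: "\<chi> \<in> vir_dual \<Longrightarrow> \<chi> (u + v) = \<chi> u + \<chi> v"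
  and vir_dual_scale: "\<chi> \<in> vir_dual \<Longrightarrow> \<chi> (vir_scale c v) = c * \<chi> v"
proof -
  assume "\<chi> \<in> vir_dual"
  then interpret Vector_Spaces.linear vir_scale "(*)" \<chi> by (simp add: vir_dual_def)
  show "\<chi> (u + v) = \<chi> u + \<chi> v" "\<chi> (vir_scale c v) = c * \<chi> v" by (rule add, rule scale)
qed

lemma vir_dual_0: "\<chi> \<in> vir_dual \<Longrightarrow> \<chi> 0 = 0"
  using vir_dual_add [of \<chi> 0 0] by simp

lemma linear_form_witt_functional: "\<chi> \<in> vir_dual \<Longrightarrow> linear_form (witt_functional \<chi>)"
proof -
  assume \<chi>: "\<chi> \<in> vir_dual"
  have "(f + g, 0) = (f, 0) + (g, 0 :: complex)" "(lconst c * f, 0) = vir_scale c (f, 0)" for f g :: laurent and c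
    by (simp_all add: vir_scale_def witt_scale_eq)
  then show ?thesis
    unfolding linear_form_def witt_functional_def
    using vir_dual_add [OF \<chi>] vir_dual_scale [OF \<chi>] by metis
qed

lemma vir_dual_pair: "\<chi> \<in> vir_dual \<Longrightarrow> \<chi> (f, a) = witt_functional \<chi> f + a * \<chi> vir_z"
proof -
  assume \<chi>: "\<chi> \<in> vir_dual"
  have "(f, a) = (f, 0) + vir_scale a vir_z"
    by (simp add: vir_scale_def witt_scale_eq vir_z_def)
  then show ?thesis
    unfolding witt_functional_def using vir_dual_add [OF \<chi>] vir_dual_scale [OF \<chi>] by metis
qed

text \<open>
  The contribution of the cocycle to \<open>[f, g h] - [g, f h]\<close> is a multiple of the residue of this
  expression times \<open>h\<close>.
\<close>
definition third_wronskian :: "laurent \<Rightarrow> laurent \<Rightarrow> laurent" where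
  "third_wronskian f g = f * (laurent_deriv ^^ 3) g - (laurent_deriv ^^ 3) f * g"

text \<open>
  Since \<open>\<chi>\<close> kills all brackets with \<open>u\<close> and with \<open>v\<close>, it kills \<open>[u, f\<^sub>2 g] - [v, f\<^sub>1 g]\<close>, where \<open>f\<^sub>1\<close> and \<open>f\<^sub>2\<close> are the vector
  fields of \<open>u\<close> and \<open>v\<close>. The derivatives of \<open>g\<close> cancel in this difference.
\<close>
lemma isotropy_witt_bracket:
  assumes \<chi>: "\<chi> \<in> vir_dual" and "u \<in> isotropy \<chi>" "v \<in> isotropy \<chi>"
  shows "witt_functional \<chi> (witt_bracket (fst u) (fst v) * g)
       = \<chi> vir_z * laurent_res (third_wronskian (fst u) (fst v) * g)"
proof -
  define f1 f2 where "f1 = fst u" "f2 = fst v"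
  let ?\<phi> = "witt_functional \<chi>" and ?D3 = "(laurent_deriv ^^ 3)"
  note lin = linear_form_witt_functional [OF \<chi>]
  have "\<chi> (vir_bracket u (f2 * g, 0)) = 0" "\<chi> (vir_bracket v (f1 * g, 0)) = 0"
    using assms(2,3) by (simp_all add: isotropy_def)
  then have "?\<phi> (witt_bracket f1 (f2 * g)) + 2 * laurent_res (?D3 f1 * (f2 * g)) * \<chi> vir_z = 0"
      "?\<phi> (witt_bracket f2 (f1 * g)) + 2 * laurent_res (?D3 f2 * (f1 * g)) * \<chi> vir_z = 0"
    by (simp_all only: vir_bracket_pair vir_dual_pair [OF \<chi>] cocycle_eq fst_conv f1_f2_def)
  then have "?\<phi> (witt_bracket f1 (f2 * g)) - ?\<phi> (witt_bracket f2 (f1 * g))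
      = 2 * \<chi> vir_z * (laurent_res (?D3 f2 * (f1 * g)) - laurent_res (?D3 f1 * (f2 * g)))"
    by (simp add: algebra_simps add_eq_0_iff)
  also have "?\<phi> (witt_bracket f1 (f2 * g)) - ?\<phi> (witt_bracket f2 (f1 * g))
      = ?\<phi> (witt_bracket f1 f2 * g) + ?\<phi> (witt_bracket f1 f2 * g)"
    unfolding linear_form_diff [OF lin, symmetric] linear_form_add [OF lin, symmetric]
    by (rule arg_cong [where f = ?\<phi>])
      (simp add: witt_bracket_def laurent_deriv_mult algebra_simps)
  also have "laurent_res (?D3 f2 * (f1 * g)) - laurent_res (?D3 f1 * (f2 * g))
      = laurent_res (third_wronskian f1 f2 * g)"
    unfolding laurent_res_diff [symmetric] by (simp add: third_wronskian_def algebra_simps)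
  finally show ?thesis unfolding f1_f2_def by simp
qed

lemma top_coeff_witt_bracket:
  assumes "top_coeff f m a" "top_coeff g n b"
  shows "top_coeff (witt_bracket f g) (m + n - 1) (of_int (n - m) * (a * b))"
proof -
  have "top_coeff (f * laurent_deriv g) (m + n - 1) (of_int n * (a * b))"
    using top_coeff_mult [OF assms(1) top_coeff_deriv [OF assms(2)]] by (simp add: algebra_simps)
  moreover have "top_coeff (laurent_deriv f * g) (m + n - 1) (of_int m * (a * b))"
    using top_coeff_mult [OF top_coeff_deriv [OF assms(1)] assms(2)] by (simp add: algebra_simps)
  ultimately show ?thesis
    unfolding witt_bracket_def by (auto dest: top_coeff_diff simp: left_diff_distrib)
qed

lemma top_coeff_third_wronskian:
  assumes "top_coeff f m a" "top_coeff g n b"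
  shows "top_coeff (third_wronskian f g) (m + n - 3)
    (of_int (n * (n - 1) * (n - 2) - m * (m - 1) * (m - 2)) * (a * b))"
proof -
  have d3: "top_coeff ((laurent_deriv ^^ 3) f) (m - 3) (of_int (m * (m - 1) * (m - 2)) * a)"
    if "top_coeff f m a" for f m a
    using top_coeff_deriv [OF top_coeff_deriv [OF top_coeff_deriv [OF that]]]
    by (simp add: numeral_3_eq_3 mult_ac)
  have "top_coeff (f * (laurent_deriv ^^ 3) g) (m + n - 3) (of_int (n * (n - 1) * (n - 2)) * (a * b))"
    using top_coeff_mult [OF assms(1) d3 [OF assms(2)]] by (simp only: add_diff_eq mult_ac)
  moreover have "top_coeff ((laurent_deriv ^^ 3) f * g) (m + n - 3) (of_int (m * (m - 1) * (m - 2)) * (a * b))"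
    using top_coeff_mult [OF d3 [OF assms(1)] assms(2)] by (simp only: diff_add_eq mult_ac)
  ultimately show ?thesis
    unfolding third_wronskian_def of_int_diff left_diff_distrib by (rule top_coeff_diff)
qed

text \<open>
  Both a nontrivial Poisson core and finite codimension of the isotropy algebra imply this
  condition, and it is strong enough to give an annihilated ideal.
\<close>
definition unbounded_isotropy :: "(vir \<Rightarrow> complex) \<Rightarrow> bool" where
  "unbounded_isotropy \<chi> \<longleftrightarrow> (\<forall>M. \<exists>n\<ge>M. \<exists>v\<in>isotropy \<chi>. \<exists>a. a \<noteq> 0 \<and> top_coeff (fst v) n a)"

lemma laurent_res_nondegenerate:
  assumes "\<And>g. laurent_res (f * g) = 0"
  shows "f = 0"
proof (rule poly_mapping_eqI)
  fix n
  have "laurent_res (f * Poly_Mapping.single m 1) = Poly_Mapping.lookup f (- 1 - m)" for m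
    unfolding laurent_res_def
    by (induction f rule: poly_mapping_add_induct)
      (auto simp: mult_single lookup_single when_def distrib_right lookup_add)
  from this [of "- 1 - n"] show "Poly_Mapping.lookup f n = Poly_Mapping.lookup 0 n"
    using assms by simp
qed

text \<open>
  Take isotropy elements of degrees \<open>3 \<le> m < n < p\<close>, and write \<open>h\<close>, \<open>h'\<close> and \<open>k\<close>, \<open>k'\<close> for the brackets and the
  cocycle terms of the pairs \<open>(m, n)\<close> and \<open>(m, p)\<close>. Evaluating \<open>\<phi>\<close> on \<open>h h' g\<close> in two ways gives
  \<open>c Res(k h' g) = c Res(k' h g)\<close> for all \<open>g\<close>. If \<open>c \<noteq> 0\<close>, the nondegenerate residue pairing yields
  \<open>k h' = k' h\<close>, and the leading coefficients satisfy \<open>(n - m) (p - m) (n - p) (n + p + m - 3) = 0\<close>, which the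
  choice of degrees excludes.
\<close>
lemma unbounded_isotropy_annihilator:
  assumes \<chi>: "\<chi> \<in> vir_dual" and "unbounded_isotropy \<chi>"
  shows "\<chi> vir_z = 0 \<and> (\<exists>h. h \<noteq> 0 \<and> (\<forall>g. witt_functional \<chi> (h * g) = 0))"
proof -
  let ?\<phi> = "witt_functional \<chi>" and ?c = "\<chi> vir_z"
  obtain m u a where u: "m \<ge> 3" "u \<in> isotropy \<chi>" "a \<noteq> 0" "top_coeff (fst u) m a"
    using assms(2) unfolding unbounded_isotropy_def by blast
  obtain n v b where v: "n \<ge> m + 1" "v \<in> isotropy \<chi>" "b \<noteq> 0" "top_coeff (fst v) n b"
    using assms(2) unfolding unbounded_isotropy_def by blast
  obtain p w d where w: "p \<ge> n + 1" "w \<in> isotropy \<chi>" "d \<noteq> 0" "top_coeff (fst w) p d"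
    using assms(2) unfolding unbounded_isotropy_def by blast
  define h k h' k' where "h = witt_bracket (fst u) (fst v)" "k = third_wronskian (fst u) (fst v)"
    "h' = witt_bracket (fst u) (fst w)" "k' = third_wronskian (fst u) (fst w)"
  note defs = h_k_h'_k'_def
  have hk: "?\<phi> (h * g) = ?c * laurent_res (k * g)" "?\<phi> (h' * g) = ?c * laurent_res (k' * g)" for g
    unfolding defs using isotropy_witt_bracket [OF \<chi>] u(2) v(2) w(2) by blast+
  have c: "?c = 0"
  proof (rule ccontr)
    assume "?c \<noteq> 0"
    have "?c * laurent_res ((k * h') * g) = ?c * laurent_res ((k' * h) * g)" for g
      using hk(1) [of "h' * g"] hk(2) [of "h * g"] by (simp only: mult_ac)
    then have "laurent_res ((k * h' - k' * h) * g) = 0" for g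
      using \<open>?c \<noteq> 0\<close> by (simp add: left_diff_distrib laurent_res_diff)
    then have eq: "k * h' = k' * h"
      using laurent_res_nondegenerate by (metis eq_iff_diff_eq_0)
    let ?t = "\<lambda>n::int. n * (n - 1) * (n - 2)"
    have "top_coeff (k * h') (m + n - 3 + (m + p - 1))
        (of_int (?t n - ?t m) * (a * b) * (of_int (p - m) * (a * d)))"
      unfolding defs by (intro top_coeff_mult top_coeff_witt_bracket top_coeff_third_wronskian u v w)
    moreover have "top_coeff (k' * h) (m + p - 3 + (m + n - 1))
        (of_int (?t p - ?t m) * (a * d) * (of_int (n - m) * (a * b)))"
      unfolding defs by (intro top_coeff_mult top_coeff_witt_bracket top_coeff_third_wronskian u v w)
    moreover have "m + p - 3 + (m + n - 1) = m + n - 3 + (m + p - 1)" by simp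
    ultimately have "of_int (?t n - ?t m) * (a * b) * (of_int (p - m) * (a * d))
        = of_int (?t p - ?t m) * (a * d) * (of_int (n - m) * (a * b))"
      unfolding eq by (metis top_coeff_unique)
    then have "of_int ((?t n - ?t m) * (p - m)) * (a * a * b * d)
        = of_int ((?t p - ?t m) * (n - m)) * (a * a * b * d)"
      by (simp only: of_int_mult mult_ac)
    then have "(?t n - ?t m) * (p - m) = (?t p - ?t m) * (n - m)"
      using u(3) v(3) w(3) by (simp only: mult_cancel_right of_int_eq_iff) simp
    then have "(n - m) * (p - m) * ((n - p) * (n + p + m - 3)) = 0"
      by (simp add: algebra_simps)
    then show False using u(1) v(1) w(1) by simp
  qed
  moreover have "h \<noteq> 0"
    using top_coeff_nonzero [OF top_coeff_witt_bracket [OF u(4) v(4)]] u v by (simp add: defs)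
  ultimately show ?thesis using hk(1) by auto
qed

section \<open>Isotropy algebras of finite codimension\<close>

lemma subspace_isotropy:
  assumes "\<chi> \<in> vir_dual"
  shows "module.subspace vir_scale (isotropy \<chi>)"
proof -
  interpret vector_space vir_scale by (rule vector_space_vir_scale)
  have "vir_bracket 0 w = 0" for w
    using vir_bracket_scale_left [of 0 0 w] by simp
  then show ?thesis
    unfolding subspace_def isotropy_def
    by (simp add: vir_bracket_add_left vir_bracket_scale_left vir_dual_add [OF assms]
        vir_dual_scale [OF assms] vir_dual_0 [OF assms])
qed

text \<open>
  The form in which finite codimension is used: sufficiently many vectors, possibly with
  repetitions, have a nontrivial linear combination in \<open>U\<close>.
\<close>
lemma finite_codim_dependence:
  assumes "vir_finite_codim U" "module.subspace vir_scale U"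
  shows "\<exists>d. \<forall>u::nat \<Rightarrow> vir. \<exists>c. (\<exists>i<d. c i \<noteq> 0) \<and> (\<Sum>i<d. vir_scale (c i) (u i)) \<in> U"
proof -
  interpret vector_space vir_scale by (rule vector_space_vir_scale)
  obtain B where B: "finite B" "\<And>v. \<exists>b\<in>span B. v - b \<in> U"
    using assms(1) unfolding vir_finite_codim_def by blast
  let ?d = "Suc (card B)"
  have "\<exists>c. (\<exists>i<?d. c i \<noteq> 0) \<and> (\<Sum>i<?d. vir_scale (c i) (u i)) \<in> U" for u :: "nat \<Rightarrow> vir"
  proof -
    have "\<forall>i. \<exists>b. b \<in> span B \<and> u i - b \<in> U" using B(2) by blast
    from choice [OF this] obtain b where b: "\<And>i. b i \<in> span B" "\<And>i. u i - b i \<in> U"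
      by blast
    have "\<exists>c. (\<exists>i<?d. c i \<noteq> 0) \<and> (\<Sum>i<?d. vir_scale (c i) (b i)) = 0"
    proof (cases "inj_on b {..<?d}")
      case True
      then have "card (b ` {..<?d}) = ?d" by (simp add: card_image)
      then have "dependent (b ` {..<?d})"
        using independent_span_bound [OF B(1), of "b ` {..<?d}"] b(1) by fastforce
      then obtain e where e: "\<exists>v\<in>b ` {..<?d}. e v \<noteq> 0" "(\<Sum>v\<in>b ` {..<?d}. vir_scale (e v) v) = 0"
        using dependent_finite [of "b ` {..<?d}"] by auto
      then show ?thesis
        by (intro exI [of _ "\<lambda>i. e (b i)"]) (auto simp: sum.reindex [OF True] simp del: sum.lessThan_Suc)
    next
      case False
      then obtain i j where ij: "i < ?d" "j < ?d" "i \<noteq> j" "b i = b j"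
        unfolding inj_on_def by blast
      \<comment> \<open>Two representatives coincide, and their difference is the required relation.\<close>
      let ?c = "\<lambda>k. (if k = i then 1 else 0) - (if k = j then 1 else 0) :: complex"
      have e: "(\<Sum>k<?d. vir_scale (if k = l then 1 else 0) (b k)) = b l" if "l < ?d" for l
      proof -
        have "(\<Sum>k<?d. vir_scale (if k = l then 1 else 0) (b k)) = (\<Sum>k<?d. if k = l then b k else 0)"
          by (intro sum.cong) auto
        then show ?thesis using that by (simp del: sum.lessThan_Suc)
      qed
      have "(\<Sum>k<?d. vir_scale (?c k) (b k)) = 0"
        unfolding scale_left_diff_distrib sum_subtractf e [OF ij(1)] e [OF ij(2)] using ij by simp
      moreover have "\<exists>k<?d. ?c k \<noteq> 0" using ij(1,3) by (intro exI [of _ i]) simp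
      ultimately show ?thesis by (intro exI [of _ ?c] conjI)
    qed
    then obtain c where c: "\<exists>i<?d. c i \<noteq> 0" "(\<Sum>i<?d. vir_scale (c i) (b i)) = 0" by blast
    have "(\<Sum>i<?d. vir_scale (c i) (u i - b i)) \<in> U"
      using b(2) by (intro subspace_sum assms(2) subspace_scale)
    also have "(\<Sum>i<?d. vir_scale (c i) (u i - b i)) = (\<Sum>i<?d. vir_scale (c i) (u i))"
      by (simp only: scale_right_diff_distrib sum_subtractf c(2) diff_0_right)
    finally show ?thesis using c(1) by blast
  qed
  then show ?thesis by blast
qed

lemma finite_codim_unbounded_isotropy:
  assumes \<chi>: "\<chi> \<in> vir_dual" and "vir_finite_codim (isotropy \<chi>)"
  shows "unbounded_isotropy \<chi>"
  unfolding unbounded_isotropy_def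
proof
  fix M :: int
  obtain d where d: "\<And>u::nat \<Rightarrow> vir. \<exists>c. (\<exists>i<d. c i \<noteq> 0) \<and> (\<Sum>i<d. vir_scale (c i) (u i)) \<in> isotropy \<chi>"
    using finite_codim_dependence [OF assms(2) subspace_isotropy [OF \<chi>]] by blast
  let ?u = "\<lambda>i. vir_basis (T (M + int i))"
  obtain c where c: "\<exists>i<d. c i \<noteq> 0" "(\<Sum>i<d. vir_scale (c i) (?u i)) \<in> isotropy \<chi>"
    using d [of ?u] by blast
  define v where "v = (\<Sum>i<d. vir_scale (c i) (?u i))"
  have "fst v = (\<Sum>i<d. Poly_Mapping.single (M + int i) (c i))"
    by (simp add: v_def fst_sum vir_scale_def witt_scale_eq mult_single)
  then have lk: "Poly_Mapping.lookup (fst v) k = (\<Sum>i<d. if M + int i = k then c i else 0)" for k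
    by (simp add: lookup_sum lookup_single when_def)
  obtain i where i: "i < d" "c i \<noteq> 0" using c(1) by blast
  have "Poly_Mapping.lookup (fst v) (M + int i) = c i"
    using i(1) by (simp add: lk)
  then have "fst v \<noteq> 0" using i(2) by auto
  then obtain n a where na: "a \<noteq> 0" "top_coeff (fst v) n a" using top_coeff_exists by blast
  have "n \<ge> M"
  proof (rule ccontr)
    assume "\<not> n \<ge> M"
    then have "Poly_Mapping.lookup (fst v) n = 0" by (auto simp: lk intro!: sum.neutral)
    then show False using na by (simp add: top_coeff_def)
  qed
  then show "\<exists>n\<ge>M. \<exists>v\<in>isotropy \<chi>. \<exists>a. a \<noteq> 0 \<and> top_coeff (fst v) n a"
    using na c(2) unfolding v_def by blast
qed

text \<open>
  The quotient \<open>L / q L\<close> is spanned by the monomials whose exponents lie between the lowest exponent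
  \<open>l\<close> and the highest exponent \<open>r\<close> of \<open>q\<close>. A suitable monomial multiple of \<open>q\<close> expresses \<open>t\<^sup>n\<close> by monomials
  closer to that range: the leading term is eliminated for \<open>n > r\<close>, the lowest one for \<open>n < l\<close>.
\<close>
lemma monomials_mod_ideal:
  assumes "q \<noteq> 0"
  shows "\<exists>B. finite B \<and> (\<forall>v. \<exists>b\<in>module.span vir_scale B. \<exists>g a. v - b = (q * g, a))"
proof -
  interpret vector_space vir_scale by (rule vector_space_vir_scale)
  define l where "l = Min (Poly_Mapping.keys q)"
  define r where "r = Max (Poly_Mapping.keys q)"
  have ne: "Poly_Mapping.keys q \<noteq> {}" using assms by simp
  have lr: "l \<in> Poly_Mapping.keys q" "r \<in> Poly_Mapping.keys q"
    and bd: "\<And>k. k \<in> Poly_Mapping.keys q \<Longrightarrow> l \<le> k \<and> k \<le> r"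
    using ne by (simp_all add: l_def r_def)
  define B where "B = (\<lambda>n. (tpow n, 0 :: complex)) ` {l..r}"
  define V where "V = {v. \<exists>b\<in>span B. \<exists>g a. v - b = (q * g, a)}"
  have V_add: "u + v \<in> V" if uv: "u \<in> V" "v \<in> V" for u v
  proof -
    obtain b g a b' g' a' where "b \<in> span B" "u - b = (q * g, a)" "b' \<in> span B" "v - b' = (q * g', a')"
      using uv unfolding V_def by blast
    then have "b + b' \<in> span B" "(u + v) - (b + b') = (q * (g + g'), a + a')"
      by (simp_all add: span_add prod_eq_iff algebra_simps)
    then show ?thesis unfolding V_def by blast
  qed
  have V_scale: "vir_scale c v \<in> V" if v: "v \<in> V" for c v
  proof -
    obtain b g a where "b \<in> span B" "v - b = (q * g, a)" using v unfolding V_def by blast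
    then have "vir_scale c b \<in> span B" "vir_scale c v - vir_scale c b = vir_scale c (q * g, a)"
      by (simp_all add: span_scale scale_right_diff_distrib [symmetric])
    moreover have "vir_scale c (q * g, a) = (q * (lconst c * g), c * a)"
      by (simp add: vir_scale_def witt_scale_eq mult_ac)
    ultimately have "vir_scale c b \<in> span B" "vir_scale c v - vir_scale c b = (q * (lconst c * g), c * a)"
      by simp_all
    then show ?thesis unfolding V_def by blast
  qed
  have V_ideal: "(q * g, a) \<in> V" for g a
    unfolding V_def by (intro CollectI bexI [OF _ span_zero] exI) (rule diff_0_right)
  have V_0: "0 \<in> V" using V_ideal [of 0 0] by (simp add: zero_prod_def)
  have V_sum: "(\<Sum>i\<in>A. x i) \<in> V" if "\<And>i. i \<in> A \<Longrightarrow> x i \<in> V" for A and x :: "int \<Rightarrow> vir"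
    using that by (induction A rule: infinite_finite_induct) (auto intro: V_0 V_add)
  have q_sum: "q = (\<Sum>k\<in>Poly_Mapping.keys q. Poly_Mapping.single k (Poly_Mapping.lookup q k))"
    by (rule poly_mapping_eqI) (simp add: lookup_sum lookup_single when_def in_keys_iff)
  \<comment> \<open>Multiplication by a power of t moves the term of exponent e to exponent n, which is then solved for.\<close>
  have elim: "(tpow n, 0) \<in> V"
    if e: "e \<in> Poly_Mapping.keys q"
      "\<And>k. k \<in> Poly_Mapping.keys q \<Longrightarrow> k \<noteq> e \<Longrightarrow> (tpow (n - e + k), 0) \<in> V" for n e
  proof -
    let ?c = "Poly_Mapping.lookup q"
    have c: "?c e \<noteq> 0" using e(1) by (simp add: in_keys_iff)
    let ?x = "\<Sum>k\<in>Poly_Mapping.keys q - {e}. vir_scale (?c k) (tpow (n - e + k), 0)"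
    have "fst ?x = tpow (n - e) * (\<Sum>k\<in>Poly_Mapping.keys q - {e}. Poly_Mapping.single k (?c k))"
      by (simp add: fst_sum vir_scale_def witt_scale_eq mult_single sum_distrib_left)
    also have "(\<Sum>k\<in>Poly_Mapping.keys q - {e}. Poly_Mapping.single k (?c k)) = q - Poly_Mapping.single e (?c e)"
      using e(1) by (subst q_sum) (simp add: sum.remove [OF _ e(1)])
    finally have "fst ?x = tpow (n - e) * q - Poly_Mapping.single n (?c e)"
      by (simp add: right_diff_distrib mult_single)
    then have "q * tpow (n - e) + lconst (- 1) * fst ?x = Poly_Mapping.single n (?c e)"
      by (simp only: single_uminus single_one) (simp add: mult.commute)
    moreover have "lconst (1 / ?c e) * Poly_Mapping.single n (?c e) = tpow n"
      using c by (simp add: mult_single)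
    moreover have "snd ?x = 0" by (simp add: snd_sum vir_scale_def)
    ultimately have eq: "(tpow n, 0) = vir_scale (1 / ?c e) ((q * tpow (n - e), 0) + vir_scale (- 1) ?x)"
      unfolding prod_eq_iff vir_scale_def witt_scale_eq fst_add snd_add fst_conv snd_conv by simp
    have "?x \<in> V" using e(2) by (intro V_sum V_scale) auto
    then show ?thesis unfolding eq by (intro V_scale V_add V_ideal)
  qed
  have mono: "(tpow n, 0) \<in> V" for n
  \<comment> \<open>Induction on the distance of n from the range; it is 0 within the range.\<close>
  proof (induction "nat (max (n - r) (l - n))" arbitrary: n rule: less_induct)
    case less
    consider "l \<le> n" "n \<le> r" | "n > r" | "n < l" by linarith
    then show ?case
    proof cases
      case 1
      then have "(tpow n, 0) \<in> span B" by (intro span_base) (simp add: B_def)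
      then show ?thesis
        unfolding V_def by (intro CollectI bexI exI [of _ 0]) (simp_all add: zero_prod_def)
    next
      case 2
      show ?thesis
      proof (rule elim [OF lr(2)])
        fix k assume "k \<in> Poly_Mapping.keys q" "k \<noteq> r"
        then have "l \<le> k" "k < r" using bd [of k] by auto
        then show "(tpow (n - r + k), 0) \<in> V" using 2 by (intro less) auto
      qed
    next
      case 3
      show ?thesis
      proof (rule elim [OF lr(1)])
        fix k assume "k \<in> Poly_Mapping.keys q" "k \<noteq> l"
        then have "l < k" "k \<le> r" using bd [of k] by auto
        then show "(tpow (n - l + k), 0) \<in> V" using 3 by (intro less) auto
      qed
    qed
  qed
  have "v \<in> V" for v
  proof (induction v rule: vir_induct)
    case (single n c)
    show ?case using V_scale [OF mono] by simp
  next
    case (z c)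
    show ?case using V_ideal [of 0 c] by (simp add: vir_scale_def vir_z_def witt_scale_eq)
  next
    case (add u v)
    then show ?case by (rule V_add)
  qed
  then show ?thesis unfolding V_def by (intro exI [of _ B]) (auto simp: B_def)
qed

text \<open>
  A bracket with a multiple of \<open>h\<^sup>2\<close> involves at most one derivative of \<open>h\<^sup>2\<close>, so it is still a multiple
  of \<open>h\<close>. Hence \<open>h\<^sup>2 L\<close> lies in the isotropy algebra.
\<close>
lemma annihilator_finite_codim:
  assumes \<chi>: "\<chi> \<in> vir_dual" and z: "\<chi> vir_z = 0" and h: "h \<noteq> 0" "\<And>g. witt_functional \<chi> (h * g) = 0"
  shows "vir_finite_codim (isotropy \<chi>)"
proof -
  have iso: "(h * h * g, a) \<in> isotropy \<chi>" for g a
  proof -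
    have "\<chi> (vir_bracket (h * h * g, a) w) = 0" for w
    proof -
      let ?f = "fst w"
      have "witt_bracket (h * h * g) ?f = h * (h * g * laurent_deriv ?f
          - (laurent_deriv h * g + laurent_deriv (h * g)) * ?f)"
        by (simp add: witt_bracket_def laurent_deriv_mult algebra_simps)
      then show ?thesis
        by (simp only: vir_bracket_pair vir_dual_pair [OF \<chi>] z fst_conv h(2)) simp
    qed
    then show ?thesis by (simp add: isotropy_def)
  qed
  have "h * h \<noteq> 0" using h(1) by simp
  from monomials_mod_ideal [OF this]
  obtain B where B: "finite B" "\<And>v. \<exists>b\<in>module.span vir_scale B. \<exists>g a. v - b = (h * h * g, a)"
    by blast
  have "\<exists>b\<in>module.span vir_scale B. v - b \<in> isotropy \<chi>" for v
  proof -
    obtain b g a where b: "b \<in> module.span vir_scale B" "v - b = (h * h * g, a)" using B(2) by blast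
    have "v - b \<in> isotropy \<chi>" unfolding b(2) by (rule iso)
    then show ?thesis using b(1) by blast
  qed
  then show ?thesis
    unfolding vir_finite_codim_def using B(1) by blast
qed

section \<open>Calculus in the symmetric algebra\<close>

lemma sym_bracket_0 [simp]: "sym_bracket 0 q = 0" "sym_bracket p 0 = 0"
  using sym_bracket_const_left [of 0 q] sym_bracket_const_right [of p 0] by (simp_all add: sym_const_hom)

lemma sym_bracket_1 [simp]: "sym_bracket 1 q = 0"
  using sym_bracket_const_left [of 1 q] by (simp add: sym_const_hom)

lemma sym_bracket_minus_left: "sym_bracket (- p) q = - sym_bracket p q"
  using sym_bracket_add_left [of p "- p" q] by (simp add: eq_neg_iff_add_eq_0 add.commute)

lemma sym_bracket_diff_left: "sym_bracket (p - p') q = sym_bracket p q - sym_bracket p' q"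
  using sym_bracket_add_left [of p "- p'" q] by (simp add: sym_bracket_minus_left)

lemma sym_incl_0 [simp]: "sym_incl 0 = 0"
  by (simp add: sym_incl_def sym_const_hom)

lemma sym_pderiv_0 [simp]: "sym_pderiv i 0 = 0"
  by (simp add: sym_pderiv_def)

lemma sym_pderiv_sum: "sym_pderiv i (\<Sum>x\<in>A. f x) = (\<Sum>x\<in>A. sym_pderiv i (f x))"
  by (induction A rule: infinite_finite_induct) (simp_all add: sym_pderiv_add)

lemma sym_ev_0 [simp]: "sym_ev \<chi> 0 = 0"
  using sym_ev_hom(3) [of \<chi> 0] by (simp add: sym_const_hom)

lemma sym_ev_1 [simp]: "sym_ev \<chi> 1 = 1"
  using sym_ev_hom(3) [of \<chi> 1] by (simp add: sym_const_hom)

lemma sym_ev_minus: "sym_ev \<chi> (- p) = - sym_ev \<chi> p"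
  using sym_ev_hom(1) [of \<chi> p "- p"] by (simp add: eq_neg_iff_add_eq_0 add.commute)

lemma sym_ev_diff: "sym_ev \<chi> (p - q) = sym_ev \<chi> p - sym_ev \<chi> q"
  using sym_ev_hom(1) [of \<chi> p "- q"] by (simp add: sym_ev_minus)

lemma sym_ev_sum: "sym_ev \<chi> (\<Sum>x\<in>A. f x) = (\<Sum>x\<in>A. sym_ev \<chi> (f x))"
  by (induction A rule: infinite_finite_induct) (simp_all add: sym_ev_hom)

lemma lookup_sym_pderiv:
  "Poly_Mapping.lookup (sym_pderiv i p) m
     = of_nat (Suc (Poly_Mapping.lookup m i)) * Poly_Mapping.lookup p (m + Poly_Mapping.single i 1)"
proof (induction p rule: poly_mapping_add_induct)
  case zero
  show ?case by simp
next
  case (single n c)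
  show ?case
  proof (cases "Poly_Mapping.lookup n i = 0")
    case True
    then have "n \<noteq> m + Poly_Mapping.single i 1"
      by (metis One_nat_def add_Suc_right lookup_add lookup_single_eq nat.distinct(1))
    then show ?thesis using True by (simp add: sym_pderiv_single lookup_single when_def)
  next
    case False
    have "n - Poly_Mapping.single i 1 = m \<longleftrightarrow> n = m + Poly_Mapping.single i 1"
    proof
      assume "n - Poly_Mapping.single i 1 = m"
      then show "n = m + Poly_Mapping.single i 1"
        using False by (intro poly_mapping_eqI) (auto simp: lookup_add lookup_minus lookup_single when_def)
    qed simp
    then show ?thesis
      by (auto simp: sym_pderiv_single lookup_single when_def lookup_add)
  qed
next
  case (add p q)
  then show ?case by (simp add: sym_pderiv_add lookup_add algebra_simps)
qed

lemma sym_pderiv_commute: "sym_pderiv i (sym_pderiv j p) = sym_pderiv j (sym_pderiv i p)"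
  by (cases "i = j", simp, rule poly_mapping_eqI)
    (simp add: lookup_sym_pderiv lookup_add lookup_single when_def add_ac mult.left_commute)

lemma sym_pderiv_incl: "sym_pderiv (T n) (sym_incl v) = sym_const (Poly_Mapping.lookup (fst v) n)"
proof (induction v rule: vir_induct)
  case (single k c)
  show ?case
    unfolding sym_incl_scale_basis
    by (simp add: sym_pderiv_mult sym_pderiv_var vir_scale_def lookup_single when_def sym_const_hom)
next
  case (z c)
  have "sym_pderiv (T n) (sym_incl (vir_scale c (vir_basis Z))) = 0"
    unfolding sym_incl_scale_basis by (simp add: sym_pderiv_mult sym_pderiv_var)
  then show ?case by (simp add: vir_scale_def vir_z_def sym_const_hom)
next
  case (add u v)
  then show ?case by (simp add: sym_incl_add sym_pderiv_add lookup_add sym_const_hom)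
qed

lemma vir_bracket_scale_right: "vir_bracket u (vir_scale c v) = vir_scale c (vir_bracket u v)"
proof -
  interpret vector_space vir_scale by (rule vector_space_vir_scale)
  show ?thesis
    using vir_bracket_scale_left [of c v u] vir_bracket_antisym [of u] by simp
qed

lemma sym_bracket_incl_right:
  assumes "finite A" "sym_indets p \<subseteq> A"
  shows "sym_bracket p (sym_incl v) = (\<Sum>i\<in>A. sym_pderiv i p * sym_incl (vir_bracket (vir_basis i) v))"
proof -
  have basis: "sym_bracket p (sym_incl (vir_scale c (vir_basis j)))
      = (\<Sum>i\<in>A. sym_pderiv i p * sym_incl (vir_bracket (vir_basis i) (vir_scale c (vir_basis j))))" for c j
  proof -
    have "sym_indets (sym_var j) \<subseteq> {j}" by (simp add: sym_indets_def sym_var_def)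
    then have "sym_bracket p (sym_var j) = (\<Sum>i\<in>A. sym_pderiv i p * sym_incl (vir_bracket (vir_basis i) (vir_basis j)))"
      using assms by (subst sym_bracket_superset [of A p "{j}"]) (simp_all add: sym_pderiv_var)
    then show ?thesis
      by (simp add: vir_bracket_scale_right sym_incl_scale sym_incl_basis sym_bracket_mult_right sum_distrib_left
          mult.left_commute)
  qed
  show ?thesis
  proof (induction v rule: vir_induct)
    case (single n c)
    show ?case by (rule basis)
  next
    case (z c)
    show ?case using basis [of c Z] by simp
  next
    case (add u v)
    then show ?case
      by (simp add: sym_incl_add sym_bracket_add_right vir_bracket_add_right distrib_left sum.distrib)
  qed
qed

lemma sym_bracket_prod_left:
  "finite A \<Longrightarrow> sym_bracket (\<Prod>i\<in>A. f i) q = (\<Sum>i\<in>A. sym_bracket (f i) q * (\<Prod>j\<in>A - {i}. f j))"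
proof (induction A rule: finite_induct)
  case empty
  show ?case by simp
next
  case (insert x A)
  have "(\<Sum>i\<in>A. sym_bracket (f i) q * (\<Prod>j\<in>insert x A - {i}. f j))
      = (\<Sum>i\<in>A. f x * (sym_bracket (f i) q * (\<Prod>j\<in>A - {i}. f j)))"
  proof (rule sum.cong [OF refl])
    fix i assume "i \<in> A"
    then have "insert x A - {i} = insert x (A - {i})" using insert.hyps by auto
    then show "sym_bracket (f i) q * (\<Prod>j\<in>insert x A - {i}. f j)
        = f x * (sym_bracket (f i) q * (\<Prod>j\<in>A - {i}. f j))"
      using insert.hyps by (simp add: mult.left_commute)
  qed
  then show ?case
    using insert by (simp add: sym_bracket_mult_left sum_distrib_left add.commute)
qed

section \<open>Poisson ideals given by generators\<close>

lemma ideal_gen_base: "p \<in> S \<Longrightarrow> p \<in> ideal_gen S"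
  unfolding ideal_gen_def by (rule module.span_base [OF module_times])

lemma is_ideal_ideal_gen: "is_ideal (ideal_gen S)"
  unfolding is_ideal_def ideal_gen_def by (rule module.subspace_span [OF module_times])

lemma ideal_0: "is_ideal I \<Longrightarrow> 0 \<in> I"
  and ideal_add: "is_ideal I \<Longrightarrow> p \<in> I \<Longrightarrow> q \<in> I \<Longrightarrow> p + q \<in> I"
  and ideal_mult: "is_ideal I \<Longrightarrow> p \<in> I \<Longrightarrow> c * p \<in> I"
  by (simp_all add: is_ideal_iff)

lemma ideal_minus: "is_ideal I \<Longrightarrow> p \<in> I \<Longrightarrow> - p \<in> I"
  using ideal_mult [of I p "- 1"] by simp

lemma ideal_diff: "is_ideal I \<Longrightarrow> p \<in> I \<Longrightarrow> q \<in> I \<Longrightarrow> p - q \<in> I"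
  using ideal_add [of I p "- q"] ideal_minus [of I q] by simp

lemma ideal_sum: "is_ideal I \<Longrightarrow> (\<And>x. x \<in> A \<Longrightarrow> f x \<in> I) \<Longrightarrow> (\<Sum>x\<in>A. f x) \<in> I"
  by (induction A rule: infinite_finite_induct) (auto intro: ideal_0 ideal_add)

lemma ideal_gen_least: "is_ideal I \<Longrightarrow> S \<subseteq> I \<Longrightarrow> ideal_gen S \<subseteq> I"
  unfolding is_ideal_def ideal_gen_def by (rule module.span_minimal [OF module_times])

text \<open>
  The bracket is a derivation in both arguments, so stability under brackets can be tested on
  generators of the ideal and generators of the algebra.
\<close>
lemma poisson_ideal_ideal_gen:
  assumes "\<And>s i. s \<in> S \<Longrightarrow> sym_bracket s (sym_var i) \<in> ideal_gen S"
  shows "poisson_ideal (ideal_gen S)"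
proof -
  note ideal = is_ideal_ideal_gen [of S]
  have bracket_var: "sym_bracket p (sym_var i) \<in> ideal_gen S" if "p \<in> ideal_gen S" for p i
  proof -
    let ?I = "{p \<in> ideal_gen S. sym_bracket p (sym_var i) \<in> ideal_gen S}"
    have "is_ideal ?I"
      unfolding is_ideal_iff
      by (auto simp: sym_bracket_add_left sym_bracket_mult_left
          intro!: ideal_0 [OF ideal] ideal_add [OF ideal] ideal_mult [OF ideal])
    moreover have "S \<subseteq> ?I" using assms ideal_gen_base by blast
    ultimately have "ideal_gen S \<subseteq> ?I" by (rule ideal_gen_least)
    then show ?thesis using that by blast
  qed
  have "sym_bracket p q \<in> ideal_gen S" if p: "p \<in> ideal_gen S" for p q
  proof (induction q rule: sym_induct)
    case (const c)
    show ?case by (simp add: ideal_0 [OF ideal])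
  next
    case (var i)
    show ?case by (rule bracket_var [OF p])
  next
    case (add q r)
    then show ?case by (simp add: sym_bracket_add_right ideal_add [OF ideal])
  next
    case (mult q r)
    then show ?case
      by (simp add: sym_bracket_mult_right mult.commute [of "sym_bracket p q"] ideal_add [OF ideal]
          ideal_mult [OF ideal])
  qed
  then show ?thesis using ideal by (simp add: poisson_ideal_def)
qed

lemma is_ideal_ev_kernel: "is_ideal (ev_kernel \<chi>)"
  by (simp add: is_ideal_iff ev_kernel_def sym_ev_hom)

lemma poisson_core_sym_bracket: "F \<in> poisson_core \<chi> \<Longrightarrow> sym_bracket F q \<in> poisson_core \<chi>"
  using poisson_core_greatest(1) [of \<chi>] by (simp add: poisson_ideal_def)

lemma is_ideal_poisson_core: "is_ideal (poisson_core \<chi>)"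
  using poisson_core_greatest(1) [of \<chi>] by (simp add: poisson_ideal_def)

lemma poisson_core_sym_ev: "F \<in> poisson_core \<chi> \<Longrightarrow> sym_ev \<chi> F = 0"
  using poisson_core_greatest(2) [of \<chi>] by (auto simp: ev_kernel_def)

text \<open>The criterion by which all lower bounds for the Poisson core are obtained.\<close>
lemma ideal_gen_subset_poisson_core:
  assumes "\<And>s i. s \<in> S \<Longrightarrow> sym_bracket s (sym_var i) \<in> ideal_gen S"
    and "\<And>s. s \<in> S \<Longrightarrow> sym_ev \<chi> s = 0"
  shows "ideal_gen S \<subseteq> poisson_core \<chi>"
  using poisson_core_greatest(3) [OF poisson_ideal_ideal_gen [OF assms(1)]
      ideal_gen_least [OF is_ideal_ev_kernel]] assms(2)
  by (auto simp: ev_kernel_def)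

lemma central_ideal_subset_poisson_core:
  assumes "\<chi> \<in> vir_dual"
  shows "ideal_gen {sym_incl vir_z - sym_const (\<chi> vir_z)} \<subseteq> poisson_core \<chi>"
proof (rule ideal_gen_subset_poisson_core)
  fix s :: sym_vir and i assume s: "s \<in> {sym_incl vir_z - sym_const (\<chi> vir_z)}"
  have "sym_bracket s (sym_var i) = 0"
    using s sym_bracket_incl [of vir_z "vir_basis i"]
    by (simp add: sym_bracket_diff_left sym_incl_basis vir_bracket_z)
  then show "sym_bracket s (sym_var i) \<in> ideal_gen {sym_incl vir_z - sym_const (\<chi> vir_z)}"
    using ideal_0 [OF is_ideal_ideal_gen] by simp
next
  fix s assume "s \<in> {sym_incl vir_z - sym_const (\<chi> vir_z)}"
  then show "sym_ev \<chi> s = 0" by (simp add: sym_ev_diff sym_ev_incl [OF assms] sym_ev_hom)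
qed

section \<open>A nontrivial Poisson core has a nonzero differential\<close>

definition sym_monom_degree :: "vir_monom \<Rightarrow> nat" where
  "sym_monom_degree m = (\<Sum>i\<in>Poly_Mapping.keys m. Poly_Mapping.lookup m i)"

lemma sym_monom_degree_add: "sym_monom_degree (m + n) = sym_monom_degree m + sym_monom_degree n"
  unfolding sym_monom_degree_def by (rule setsum_keys_plus_distrib) simp_all

text \<open>
  A polynomial all of whose iterated derivatives vanish at one point is zero. By induction
  on the degree, the first derivatives of \<open>F\<close> are zero, so \<open>F\<close> is constant.
\<close>
lemma derivatives_vanish_imp_0:
  assumes closed: "\<And>F i. F \<in> A \<Longrightarrow> sym_pderiv i F \<in> A"
    and ev: "\<And>F. F \<in> A \<Longrightarrow> sym_ev \<chi> F = 0" and "F \<in> A"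
  shows "F = 0"
proof -
  have "F = 0" if "F \<in> A" "\<And>m. m \<in> Poly_Mapping.keys F \<Longrightarrow> sym_monom_degree m < n" for F n
    using that
  proof (induction n arbitrary: F)
    case 0
    then show ?case by (metis equals0I keys_eq_empty not_less_zero)
  next
    case (Suc n)
    have d0: "sym_pderiv i F = 0" for i
    proof (rule Suc.IH [OF closed [OF Suc.prems(1)]])
      fix m assume "m \<in> Poly_Mapping.keys (sym_pderiv i F)"
      then have "m + Poly_Mapping.single i 1 \<in> Poly_Mapping.keys F"
        by (simp add: in_keys_iff lookup_sym_pderiv)
      from Suc.prems(2) [OF this] show "sym_monom_degree m < n"
        by (simp add: sym_monom_degree_add) (simp add: sym_monom_degree_def)
    qed
    have "Poly_Mapping.lookup F m = 0" if "m \<noteq> 0" for m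
    proof -
      obtain i where i: "Poly_Mapping.lookup m i \<noteq> 0"
        using \<open>m \<noteq> 0\<close> by (metis lookup_zero poly_mapping_eqI)
      then have "m - Poly_Mapping.single i 1 + Poly_Mapping.single i 1 = m"
        by (intro poly_mapping_eqI) (auto simp: lookup_add lookup_minus lookup_single when_def)
      then show ?thesis
        using lookup_sym_pderiv [of i F "m - Poly_Mapping.single i 1"] d0 [of i]
        by (simp del: of_nat_Suc)
    qed
    then have F: "F = sym_const (Poly_Mapping.lookup F 0)"
      by (intro poly_mapping_eqI) (auto simp: sym_const_def lookup_single when_def)
    then have "sym_ev \<chi> F = Poly_Mapping.lookup F 0" by (metis sym_ev_hom(3))
    then show ?case using F ev [OF Suc.prems(1)] by (simp add: sym_const_hom)
  qed
  moreover have "\<exists>n. \<forall>m\<in>Poly_Mapping.keys F. sym_monom_degree m < n"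
    using finite_nat_set_iff_bounded [of "sym_monom_degree ` Poly_Mapping.keys F"] by auto
  ultimately show ?thesis using assms(3) by blast
qed

definition specialize_z :: "complex \<Rightarrow> sym_vir \<Rightarrow> sym_vir" where
  "specialize_z c = sym_subst sym_const (\<lambda>i. case i of T n \<Rightarrow> sym_var (T n) | Z \<Rightarrow> sym_const c)"

lemma coeff_hom_sym_const: "coeff_hom sym_const"
  by (simp add: coeff_hom_def sym_const_hom)

lemma specialize_z_hom:
  "specialize_z c (p + q) = specialize_z c p + specialize_z c q"
  "specialize_z c (p * q) = specialize_z c p * specialize_z c q"
  "specialize_z c (sym_const a) = sym_const a"
  "specialize_z c (sym_var i) = (case i of T n \<Rightarrow> sym_var (T n) | Z \<Rightarrow> sym_const c)"
  unfolding specialize_z_def using coeff_hom_sym_const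
  by (simp_all add: sym_subst_add sym_subst_mult)

lemma diff_specialize_z: "p - specialize_z c p \<in> ideal_gen {sym_incl vir_z - sym_const c}"
proof (induction p rule: sym_induct)
  case (const a)
  show ?case by (simp add: specialize_z_hom ideal_0 [OF is_ideal_ideal_gen])
next
  case (var i)
  show ?case
    using sym_incl_basis [of Z]
    by (cases i) (simp_all add: specialize_z_hom ideal_0 [OF is_ideal_ideal_gen] ideal_gen_base)
next
  case (add p q)
  then show ?case
    using ideal_add [OF is_ideal_ideal_gen] by (simp add: specialize_z_hom add_diff_add)
next
  case (mult p q)
  have "p * q - specialize_z c (p * q) = p * (q - specialize_z c q) + specialize_z c q * (p - specialize_z c p)"
    by (simp add: specialize_z_hom algebra_simps)
  then show ?case
    using mult by (simp add: ideal_add [OF is_ideal_ideal_gen] ideal_mult [OF is_ideal_ideal_gen])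
qed

lemma sym_pderiv_Z_specialize_z: "sym_pderiv Z (specialize_z c p) = 0"
proof (induction p rule: sym_induct)
  case (var i)
  show ?case by (cases i) (simp_all add: specialize_z_hom sym_pderiv_var)
qed (simp_all add: specialize_z_hom sym_pderiv_add sym_pderiv_mult)

text \<open>
  Suppose that all derivatives along the \<open>t\<^sup>n \<partial>\<^sub>t\<close> of elements of the core \<open>P\<close> vanish at \<open>\<chi>\<close>. For \<open>F\<close> in \<open>P\<close>, the
  bracket of \<open>\<partial>\<^sub>n F\<close> with a generator differs from \<open>\<partial>\<^sub>n\<close> of the bracket only by a linear combination of the
  \<open>\<partial>\<^sub>j F\<close>, so \<open>P\<close> and these derivatives generate a Poisson ideal. By assumption it lies in the kernel of
  evaluation, hence in \<open>P\<close>. Thus \<open>P\<close> is stable under the derivatives along the \<open>t\<^sup>n \<partial>\<^sub>t\<close>. Specialising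
  \<open>z\<close> to \<open>\<chi>(z)\<close> moves elements of \<open>P\<close> only by multiples of \<open>z - \<chi>(z)\<close> and makes the derivative along \<open>z\<close> zero
  as well; what is left vanishes to infinite order at \<open>\<chi>\<close>.
\<close>
lemma poisson_core_derivative_nonzero:
  assumes \<chi>: "\<chi> \<in> vir_dual"
    and "\<not> poisson_core \<chi> \<subseteq> ideal_gen {sym_incl vir_z - sym_const (\<chi> vir_z)}"
  shows "\<exists>F\<in>poisson_core \<chi>. \<exists>n. sym_ev \<chi> (sym_pderiv (T n) F) \<noteq> 0"
proof (rule ccontr)
  let ?P = "poisson_core \<chi>" and ?Z = "ideal_gen {sym_incl vir_z - sym_const (\<chi> vir_z)}"
  assume "\<not> ?thesis"
  then have ev: "\<And>F n. F \<in> ?P \<Longrightarrow> sym_ev \<chi> (sym_pderiv (T n) F) = 0" by blast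
  define S where "S = ?P \<union> {sym_pderiv (T n) F | n F. F \<in> ?P}"
  have dS: "sym_pderiv (T n) F \<in> S" if "F \<in> ?P" for n F
    using that unfolding S_def by blast
  have "ideal_gen S \<subseteq> ?P"
  proof (rule ideal_gen_subset_poisson_core)
    fix s i assume "s \<in> S"
    then consider "s \<in> ?P" | n F where "F \<in> ?P" "s = sym_pderiv (T n) F" unfolding S_def by blast
    then show "sym_bracket s (sym_var i) \<in> ideal_gen S"
    proof cases
      case 1
      then have "sym_bracket s (sym_var i) \<in> S" using poisson_core_sym_bracket by (simp add: S_def)
      then show ?thesis by (rule ideal_gen_base)
    next
      case 2
      let ?A = "sym_indets F \<union> sym_indets s"
      let ?l = "\<lambda>j. vir_bracket (vir_basis j) (vir_basis i)"
      have "sym_bracket F (sym_var i) = (\<Sum>j\<in>?A. sym_pderiv j F * sym_incl (?l j))"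
        using sym_bracket_incl_right [of ?A F "vir_basis i"] by (simp add: sym_incl_basis)
      then have "sym_pderiv (T n) (sym_bracket F (sym_var i)) =
          (\<Sum>j\<in>?A. sym_pderiv j F * sym_pderiv (T n) (sym_incl (?l j)))
          + (\<Sum>j\<in>?A. sym_pderiv j s * sym_incl (?l j))"
        by (simp add: sym_pderiv_sum sym_pderiv_mult sum.distrib 2(2) sym_pderiv_commute [of "T n"])
      also have "(\<Sum>j\<in>?A. sym_pderiv j s * sym_incl (?l j)) = sym_bracket s (sym_var i)"
        using sym_bracket_incl_right [of ?A s "vir_basis i"] by (simp add: sym_incl_basis)
      finally have eq: "sym_bracket s (sym_var i) = sym_pderiv (T n) (sym_bracket F (sym_var i))
          - (\<Sum>j\<in>?A. sym_pderiv (T n) (sym_incl (?l j)) * sym_pderiv j F)"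
        by (simp add: mult.commute)
      have correction: "sym_pderiv (T n) (sym_incl (?l j)) * sym_pderiv j F \<in> ideal_gen S" for j
      proof (cases j)
        case (T k)
        then show ?thesis
          using dS [OF 2(1)] by (intro ideal_mult [OF is_ideal_ideal_gen] ideal_gen_base) simp
      next
        case Z
        \<comment> \<open>The derivative along z need not lie in S, but z is central and the term is zero.\<close>
        then show ?thesis by (simp add: vir_bracket_z ideal_0 [OF is_ideal_ideal_gen])
      qed
      then show ?thesis
        unfolding eq
        by (intro ideal_diff ideal_sum is_ideal_ideal_gen correction
            ideal_gen_base [OF dS] poisson_core_sym_bracket 2(1))
    qed
  next
    fix s assume "s \<in> S"
    then show "sym_ev \<chi> s = 0" unfolding S_def using ev poisson_core_sym_ev by blast
  qed
  then have dP: "sym_pderiv (T n) F \<in> ?P" if "F \<in> ?P" for n F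
    using dS [OF that] ideal_gen_base by blast
  have "specialize_z (\<chi> vir_z) F = 0" if F: "F \<in> ?P" for F
  proof (rule derivatives_vanish_imp_0)
    let ?A = "{G \<in> ?P. sym_pderiv Z G = 0}"
    fix G i assume G: "G \<in> ?A"
    show "sym_pderiv i G \<in> ?A"
      using G dP ideal_0 [OF is_ideal_poisson_core]
      by (cases i) (auto simp: sym_pderiv_commute [of Z])
    show "sym_ev \<chi> G = 0" using G poisson_core_sym_ev by blast
  next
    have "F - specialize_z (\<chi> vir_z) F \<in> ?P"
      using diff_specialize_z central_ideal_subset_poisson_core [OF \<chi>] by (rule set_rev_mp)
    from ideal_diff [OF is_ideal_poisson_core F this] show "specialize_z (\<chi> vir_z) F \<in> {G \<in> ?P. sym_pderiv Z G = 0}"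
      by (simp add: sym_pderiv_Z_specialize_z)
  qed
  then have "?P \<subseteq> ?Z" using diff_specialize_z [of _ "\<chi> vir_z"] by (metis diff_zero subsetI)
  then show False using assms(2) by blast
qed

section \<open>A nontrivial Poisson core gives isotropy elements of high degree\<close>

text \<open>
  The differential of \<open>F\<close> at the point \<open>\<chi>\<close> of the dual space, which is an element of the Lie algebra because
  \<open>F\<close> is a polynomial on the dual space.
\<close>
definition differential :: "(vir \<Rightarrow> complex) \<Rightarrow> sym_vir \<Rightarrow> vir" where
  "differential \<chi> F = (\<Sum>i\<in>sym_indets F. vir_scale (sym_ev \<chi> (sym_pderiv i F)) (vir_basis i))"

lemma vir_bracket_sum_left:
  "vir_bracket (\<Sum>i\<in>A. vir_scale (c i) (x i)) w = (\<Sum>i\<in>A. vir_scale (c i) (vir_bracket (x i) w))"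
proof -
  interpret vector_space vir_scale by (rule vector_space_vir_scale)
  have "vir_bracket 0 w = 0" using vir_bracket_scale_left [of 0 0 w] by simp
  then show ?thesis
    by (induction A rule: infinite_finite_induct) (simp_all add: vir_bracket_add_left vir_bracket_scale_left)
qed

lemma vir_dual_sum: "\<chi> \<in> vir_dual \<Longrightarrow> \<chi> (\<Sum>i\<in>A. vir_scale (c i) (x i)) = (\<Sum>i\<in>A. c i * \<chi> (x i))"
  by (induction A rule: infinite_finite_induct) (simp_all add: vir_dual_0 vir_dual_add vir_dual_scale)

text \<open>Evaluation at \<open>\<chi>\<close> of \<open>{F, w}\<close> equals \<open>\<chi>([d F, w])\<close>, and the core is stable under brackets.\<close>
lemma differential_isotropy:
  assumes \<chi>: "\<chi> \<in> vir_dual" and F: "F \<in> poisson_core \<chi>"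
  shows "differential \<chi> F \<in> isotropy \<chi>"
proof -
  have "\<chi> (vir_bracket (differential \<chi> F) w) = 0" for w
  proof -
    have "sym_ev \<chi> (sym_bracket F (sym_incl w)) = \<chi> (vir_bracket (differential \<chi> F) w)"
      by (simp add: sym_bracket_incl_right [of "sym_indets F"] differential_def vir_bracket_sum_left
          vir_dual_sum [OF \<chi>] sym_ev_sum sym_ev_hom sym_ev_incl [OF \<chi>])
    then show ?thesis using poisson_core_sym_ev [OF poisson_core_sym_bracket [OF F]] by simp
  qed
  then show ?thesis by (simp add: isotropy_def)
qed

lemma lookup_fst_sum:
  "Poly_Mapping.lookup (fst (\<Sum>i\<in>A. vir_scale (c i) (x i))) n
     = (\<Sum>i\<in>A. c i * Poly_Mapping.lookup (fst (x i)) n)"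
  by (simp add: fst_sum lookup_sum vir_scale_def)

lemma lookup_differential:
  "Poly_Mapping.lookup (fst (differential \<chi> F)) n = sym_ev \<chi> (sym_pderiv (T n) F)"
proof -
  have b: "Poly_Mapping.lookup (fst (vir_basis i)) n = (if i = T n then 1 else 0)" for i
    by (cases i) (simp_all add: vir_z_def lookup_single when_def)
  have "Poly_Mapping.lookup (fst (differential \<chi> F)) n
      = (\<Sum>i\<in>sym_indets F. if i = T n then sym_ev \<chi> (sym_pderiv i F) else 0)"
    unfolding differential_def lookup_fst_sum b by (intro sum.cong) auto
  also have "\<dots> = sym_ev \<chi> (sym_pderiv (T n) F)"
    by (simp add: sym_pderiv_eq_0)
  finally show ?thesis .
qed

text \<open>
  The differential of \<open>{F, v}\<close> is \<open>[d F, v]\<close> plus a combination of second derivatives of \<open>F\<close>, and the latter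
  only involve the variables that occur in \<open>F\<close>.
\<close>
lemma lookup_differential_bracket:
  assumes "T k \<notin> sym_indets F"
  shows "Poly_Mapping.lookup (fst (differential \<chi> (sym_bracket F (sym_incl v)))) k
     = Poly_Mapping.lookup (fst (vir_bracket (differential \<chi> F) v)) k"
proof -
  let ?l = "\<lambda>i. vir_bracket (vir_basis i) v"
  have "sym_pderiv (T k) (sym_pderiv i F) = 0" for i
    using sym_pderiv_eq_0 [OF assms] by (simp add: sym_pderiv_commute [of "T k"])
  then have "sym_pderiv (T k) (sym_bracket F (sym_incl v))
      = (\<Sum>i\<in>sym_indets F. sym_pderiv i F * sym_const (Poly_Mapping.lookup (fst (?l i)) k))"
    by (simp add: sym_bracket_incl_right [of "sym_indets F"] sym_pderiv_sum sym_pderiv_mult sym_pderiv_incl)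
  then show ?thesis
    unfolding lookup_differential
    by (simp add: differential_def vir_bracket_sum_left lookup_fst_sum sym_ev_sum sym_ev_hom)
qed

text \<open>
  If \<open>d F\<close> has degree \<open>D\<close>, then \<open>[d F, t\<^sup>N \<partial>\<^sub>t]\<close> has degree \<open>D + N - 1\<close> for \<open>N > D\<close>. For large \<open>N\<close> this
  exceeds the exponents of all variables in \<open>F\<close>, so it is also the degree of the differential of
  \<open>{F, t\<^sup>N \<partial>\<^sub>t}\<close>.
\<close>
lemma poisson_core_unbounded_isotropy:
  assumes \<chi>: "\<chi> \<in> vir_dual"
    and "\<not> poisson_core \<chi> \<subseteq> ideal_gen {sym_incl vir_z - sym_const (\<chi> vir_z)}"
  shows "unbounded_isotropy \<chi>"
  unfolding unbounded_isotropy_def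
proof
  fix M :: int
  obtain F r where F: "F \<in> poisson_core \<chi>" "sym_ev \<chi> (sym_pderiv (T r) F) \<noteq> 0"
    using poisson_core_derivative_nonzero [OF assms] by blast
  have "fst (differential \<chi> F) \<noteq> 0" using F(2) by (metis lookup_differential lookup_zero)
  then obtain D a where a: "a \<noteq> 0" "top_coeff (fst (differential \<chi> F)) D a"
    using top_coeff_exists by blast
  have "finite {k. T k \<in> sym_indets F}"
    using finite_vimageI [OF finite_sym_indets [of F], of T] by (simp add: vimage_def inj_def)
  then have "bdd_above {k. T k \<in> sym_indets F}" by (rule bdd_above_finite)
  then obtain R0 where "\<And>k. T k \<in> sym_indets F \<Longrightarrow> k \<le> R0"
    unfolding bdd_above_def by blast
  then have R: "\<And>k. T k \<in> sym_indets F \<Longrightarrow> k < R0 + 1" by fastforce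
  define N where "N = max (D + 1) (max (M - D + 1) (R0 - D + 2))"
  define n where "n = D + N - 1"
  have n: "n \<ge> M" "n \<ge> R0 + 1" "N > D" by (auto simp: n_def N_def)
  define G where "G = sym_bracket F (sym_incl (vir_basis (T N)))"
  have "top_coeff (witt_bracket (fst (differential \<chi> F)) (tpow N)) n (of_int (N - D) * a)"
    using top_coeff_witt_bracket [OF a(2) top_coeff_single [of N 1]] by (simp add: n_def)
  moreover have "fst (vir_bracket (differential \<chi> F) (vir_basis (T N)))
      = witt_bracket (fst (differential \<chi> F)) (tpow N)"
    by (simp add: vir_bracket_pair)
  moreover have "Poly_Mapping.lookup (fst (differential \<chi> G)) k
      = Poly_Mapping.lookup (fst (vir_bracket (differential \<chi> F) (vir_basis (T N)))) k" if "k \<ge> n" for k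
    unfolding G_def using R [of k] that n(2) by (intro lookup_differential_bracket) auto
  ultimately have "top_coeff (fst (differential \<chi> G)) n (of_int (N - D) * a)"
    by (simp add: top_coeff_def)
  moreover have "differential \<chi> G \<in> isotropy \<chi>"
    unfolding G_def by (intro differential_isotropy [OF \<chi>] poisson_core_sym_bracket F(1))
  moreover have "of_int (N - D) * a \<noteq> 0" using n(3) a(1) by simp
  ultimately show "\<exists>n\<ge>M. \<exists>v\<in>isotropy \<chi>. \<exists>a. a \<noteq> 0 \<and> top_coeff (fst v) n a"
    using n(1) by blast
qed

section \<open>Minors of the bracket form\<close>

lemma vir_bracket_leibniz:
  "vir_bracket (vir_bracket a b) w = vir_bracket (vir_bracket a w) b + vir_bracket a (vir_bracket b w)"
proof -
  have "vir_bracket 0 v = 0" for v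
    using vir_bracket_add_left [of 0 0 v] by simp
  then have minus: "vir_bracket (- u) v = - vir_bracket u v" for u v
    using vir_bracket_add_left [of u "- u" v] by (simp add: eq_neg_iff_add_eq_0 add.commute)
  have "vir_bracket b (vir_bracket w a) = vir_bracket (vir_bracket a w) b"
    using vir_bracket_antisym [of b "vir_bracket w a"] vir_bracket_antisym [of w a] by (simp add: minus)
  moreover have "vir_bracket w (vir_bracket a b) = - vir_bracket (vir_bracket a b) w"
    by (rule vir_bracket_antisym)
  ultimately show ?thesis
    using vir_bracket_jacobi [of a b w] by (simp add: algebra_simps)
qed

definition bracket_minor :: "nat \<Rightarrow> (nat \<Rightarrow> vir) \<Rightarrow> (nat \<Rightarrow> vir) \<Rightarrow> sym_vir" where
  "bracket_minor n u v = det (mat n n (\<lambda>(i, j). sym_incl (vir_bracket (u j) (v i))))"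

lemma bracket_minor_leibniz:
  "bracket_minor n u v = (\<Sum>p | p permutes {0..<n}.
     signof p * (\<Prod>i = 0..<n. sym_incl (vir_bracket (u (p i)) (v i))))"
  unfolding bracket_minor_def det_def
  by (auto intro!: sum.cong prod.cong simp: permutes_in_image)

text \<open>
  Bracketing with \<open>w\<close> is a derivation, so it acts on one entry \<open>[u\<^sub>j, v\<^sub>i]\<close> at a time, and by the Jacobi
  identity it acts there on \<open>u\<^sub>j\<close> or on \<open>v\<^sub>i\<close>. The terms collect to minors in which a single \<open>u\<^sub>k\<close> or \<open>v\<^sub>k\<close> is
  replaced; in particular the minors of a given size generate a Poisson ideal.
\<close>
lemma sym_bracket_bracket_minor:
  "sym_bracket (bracket_minor n u v) (sym_incl w)
     = (\<Sum>k = 0..<n. bracket_minor n (u(k := vir_bracket (u k) w)) v)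
       + (\<Sum>k = 0..<n. bracket_minor n u (v(k := vir_bracket (v k) w)))"
proof -
  let ?I = "{0..<n}"
  have summand: "sym_bracket (\<Prod>i\<in>?I. sym_incl (vir_bracket (u (p i)) (v i))) (sym_incl w)
      = (\<Sum>k\<in>?I. \<Prod>i\<in>?I. sym_incl (vir_bracket ((u(k := vir_bracket (u k) w)) (p i)) (v i)))
      + (\<Sum>k\<in>?I. \<Prod>i\<in>?I. sym_incl (vir_bracket (u (p i)) ((v(k := vir_bracket (v k) w)) i)))"
    if p: "p permutes ?I" for p
  proof -
    let ?f = "\<lambda>i. sym_incl (vir_bracket (u (p i)) (v i))"
    have 1: "(\<Prod>i\<in>?I. sym_incl (vir_bracket ((u(p k := vir_bracket (u (p k)) w)) (p i)) (v i)))
        = sym_incl (vir_bracket (vir_bracket (u (p k)) w) (v k)) * (\<Prod>i\<in>?I - {k}. ?f i)" if "k \<in> ?I" for k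
      using that permutes_inj [OF p]
      by (subst prod.remove [of _ k]) (auto intro!: prod.cong arg_cong2 [where f = "(*)"] simp: inj_eq)
    have 2: "(\<Prod>i\<in>?I. sym_incl (vir_bracket (u (p i)) ((v(k := vir_bracket (v k) w)) i)))
        = sym_incl (vir_bracket (u (p k)) (vir_bracket (v k) w)) * (\<Prod>i\<in>?I - {k}. ?f i)" if "k \<in> ?I" for k
      using that by (subst prod.remove [of _ k]) (auto intro!: prod.cong arg_cong2 [where f = "(*)"])
    have "sym_bracket (\<Prod>i\<in>?I. ?f i) (sym_incl w)
        = (\<Sum>k\<in>?I. sym_incl (vir_bracket (vir_bracket (u (p k)) w) (v k)) * (\<Prod>i\<in>?I - {k}. ?f i))
        + (\<Sum>k\<in>?I. sym_incl (vir_bracket (u (p k)) (vir_bracket (v k) w)) * (\<Prod>i\<in>?I - {k}. ?f i))"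
      by (simp only: sym_bracket_prod_left [OF finite_atLeastLessThan] sym_bracket_incl
          vir_bracket_leibniz [of "u _" "v _" w] sym_incl_add distrib_right sum.distrib)
    also have "\<dots> = (\<Sum>k\<in>?I. \<Prod>i\<in>?I. sym_incl (vir_bracket ((u(p k := vir_bracket (u (p k)) w)) (p i)) (v i)))
        + (\<Sum>k\<in>?I. \<Prod>i\<in>?I. sym_incl (vir_bracket (u (p i)) ((v(k := vir_bracket (v k) w)) i)))"
      by (intro arg_cong2 [where f = "(+)"] sum.cong refl 1 [symmetric] 2 [symmetric])
    \<comment> \<open>The index of the affected row k becomes the index p k of the affected column.\<close>
    also have "(\<Sum>k\<in>?I. \<Prod>i\<in>?I. sym_incl (vir_bracket ((u(p k := vir_bracket (u (p k)) w)) (p i)) (v i)))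
        = (\<Sum>k\<in>?I. \<Prod>i\<in>?I. sym_incl (vir_bracket ((u(k := vir_bracket (u k) w)) (p i)) (v i)))"
      by (subst (2) sum.permute [OF p]) (simp only: o_def)
    finally show ?thesis .
  qed
  have sgn: "sym_bracket (signof p * q) r = signof p * sym_bracket q r" for p :: "nat \<Rightarrow> nat" and q r
    by (cases "evenperm p") (simp_all add: sign_def sym_bracket_minus_left)
  have sum: "sym_bracket (\<Sum>x\<in>A. f x) q = (\<Sum>x\<in>A. sym_bracket (f x) q)" for A f q
    by (induction A rule: infinite_finite_induct) (simp_all add: sym_bracket_add_left)
  have "sym_bracket (bracket_minor n u v) (sym_incl w) = (\<Sum>p | p permutes ?I.
      signof p * (\<Sum>k\<in>?I. \<Prod>i\<in>?I. sym_incl (vir_bracket ((u(k := vir_bracket (u k) w)) (p i)) (v i)))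
    + signof p * (\<Sum>k\<in>?I. \<Prod>i\<in>?I. sym_incl (vir_bracket (u (p i)) ((v(k := vir_bracket (v k) w)) i))))"
    unfolding bracket_minor_leibniz sum sgn
    by (intro sum.cong refl) (simp only: summand mem_Collect_eq distrib_left)
  then show ?thesis
    unfolding bracket_minor_leibniz sum.distrib sum_distrib_left
    by (simp only: sum.swap [of _ "{p. p permutes ?I}" ?I])
qed

lemma sym_ev_bracket_minor:
  assumes "\<chi> \<in> vir_dual"
  shows "sym_ev \<chi> (bracket_minor n u v) = det (mat n n (\<lambda>(i, j). \<chi> (vir_bracket (u j) (v i))))"
proof -
  interpret ev: comm_ring_hom "sym_ev \<chi>"
    by unfold_locales (simp_all add: sym_ev_hom)
  have "map_mat (sym_ev \<chi>) (mat n n (\<lambda>(i, j). sym_incl (vir_bracket (u j) (v i))))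
      = mat n n (\<lambda>(i, j). \<chi> (vir_bracket (u j) (v i)))"
    by (rule eq_matI) (simp_all add: sym_ev_incl [OF assms])
  then show ?thesis unfolding bracket_minor_def by (metis ev.hom_det)
qed

text \<open>A linear combination of the \<open>u\<^sub>j\<close> in the isotropy algebra is a linear relation between the columns.\<close>
lemma bracket_minor_vanishes:
  assumes \<chi>: "\<chi> \<in> vir_dual" and c: "\<exists>i<n. c i \<noteq> 0"
    and iso: "(\<Sum>i<n. vir_scale (c i) (u i)) \<in> isotropy \<chi>"
  shows "sym_ev \<chi> (bracket_minor n u v) = 0"
proof -
  let ?M = "mat n n (\<lambda>(i, j). \<chi> (vir_bracket (u j) (v i)))"
  have row: "(\<Sum>j = 0..<n. \<chi> (vir_bracket (u j) (v i)) * c j) = 0" for i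
  proof -
    have "\<chi> (vir_bracket (\<Sum>j<n. vir_scale (c j) (u j)) (v i)) = 0"
      using iso unfolding isotropy_def by blast
    then show ?thesis
      by (simp add: vir_bracket_sum_left vir_dual_sum [OF \<chi>] mult.commute atLeast0LessThan)
  qed
  have "?M *\<^sub>v vec n c = 0\<^sub>v n"
    by (rule eq_vecI) (simp_all add: scalar_prod_def row)
  moreover have "vec n c \<noteq> 0\<^sub>v n"
    using c by (auto simp: vec_eq_iff)
  ultimately have "det ?M = 0"
    by (subst det_0_iff_vec_prod_zero [of _ n]) (auto intro!: exI [of _ "vec n c"])
  then show ?thesis by (simp add: sym_ev_bracket_minor [OF \<chi>])
qed

text \<open>
  For \<open>u\<^sub>j = t\<^sup>j \<partial>\<^sub>t\<close> and \<open>v\<^sub>i = t\<^sup>1\<^sup>-\<^sup>i \<partial>\<^sub>t\<close>, the functional \<open>\<psi>\<close> that reads off the coefficient of \<open>\<partial>\<^sub>t\<close> makes the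
  matrix diagonal, and its diagonal entries \<open>1 - 2 i\<close> are odd.
\<close>
lemma nonzero_bracket_minor:
  obtains \<psi> u v where "\<psi> \<in> vir_dual" "\<psi> vir_z = 0" "sym_ev \<psi> (bracket_minor n u v) \<noteq> 0"
proof -
  define \<psi> :: "vir \<Rightarrow> complex" where "\<psi> v = Poly_Mapping.lookup (fst v) 0" for v
  define u :: "nat \<Rightarrow> vir" where "u i = vir_basis (T (int i))" for i
  define v :: "nat \<Rightarrow> vir" where "v i = vir_basis (T (1 - int i))" for i
  have \<psi>: "\<psi> \<in> vir_dual"
  proof -
    interpret vector_space vir_scale by (rule vector_space_vir_scale)
    have "Vector_Spaces.linear vir_scale (*) \<psi>"
      by unfold_locales (simp_all add: \<psi>_def vir_scale_def lookup_add algebra_simps)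
    then show ?thesis by (simp add: vir_dual_def)
  qed
  have entry: "\<psi> (vir_bracket (u j) (v i)) = (if i = j then 1 - 2 * of_nat i else 0)" for i j
    by (auto simp: \<psi>_def u_def v_def vir_bracket_pair witt_bracket_def laurent_deriv_single
        mult_single lookup_minus lookup_single when_def)
  let ?M = "mat n n (\<lambda>(i, j). \<psi> (vir_bracket (u j) (v i)))"
  have "det ?M = prod_list (diag_mat ?M)"
    by (rule det_upper_triangular) (auto simp: upper_triangular_def entry)
  moreover have "1 - 2 * of_nat i \<noteq> (0 :: complex)" for i
  proof
    assume "1 - 2 * of_nat i = (0 :: complex)"
    then have "of_nat (2 * i) = (of_nat 1 :: complex)" by simp
    then have "2 * i = 1" by (simp only: of_nat_eq_iff)
    then show False by presburger
  qed
  ultimately have "sym_ev \<psi> (bracket_minor n u v) \<noteq> 0"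
    by (auto simp: sym_ev_bracket_minor [OF \<psi>] prod_list_zero_iff diag_mat_def entry)
  moreover have "\<psi> vir_z = 0" by (simp add: \<psi>_def vir_z_def)
  ultimately show ?thesis using that \<psi> by blast
qed

text \<open>
  The minors of a suitable size lie in the core. A functional \<open>\<psi>\<close> with \<open>\<psi>(z) = 0\<close> at which some minor
  does not vanish shows that this minor is not a multiple of \<open>z\<close>.
\<close>
lemma finite_codim_poisson_core:
  assumes \<chi>: "\<chi> \<in> vir_dual" and z: "\<chi> vir_z = 0" and "vir_finite_codim (isotropy \<chi>)"
  shows "\<not> poisson_core \<chi> \<subseteq> ideal_gen {sym_incl vir_z - sym_const (\<chi> vir_z)}"
proof
  assume sub: "poisson_core \<chi> \<subseteq> ideal_gen {sym_incl vir_z - sym_const (\<chi> vir_z)}"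
  obtain d where d: "\<And>u::nat \<Rightarrow> vir. \<exists>c. (\<exists>i<d. c i \<noteq> 0) \<and> (\<Sum>i<d. vir_scale (c i) (u i)) \<in> isotropy \<chi>"
    using finite_codim_dependence [OF assms(3) subspace_isotropy [OF \<chi>]] by blast
  define S where "S = {bracket_minor d u v | u v. True}"
  have minor: "bracket_minor d u v \<in> ideal_gen S" for u v
    unfolding S_def by (rule ideal_gen_base) blast
  have "ideal_gen S \<subseteq> poisson_core \<chi>"
  proof (rule ideal_gen_subset_poisson_core)
    fix s i assume "s \<in> S"
    then obtain u v where s: "s = bracket_minor d u v" unfolding S_def by blast
    show "sym_bracket s (sym_var i) \<in> ideal_gen S"
      unfolding s sym_incl_basis [symmetric] sym_bracket_bracket_minor
      by (intro ideal_add ideal_sum is_ideal_ideal_gen minor)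
  next
    fix s assume "s \<in> S"
    then show "sym_ev \<chi> s = 0" unfolding S_def using bracket_minor_vanishes [OF \<chi>] d by blast
  qed
  moreover obtain \<psi> u v where \<psi>: "\<psi> \<in> vir_dual" "\<psi> vir_z = 0" "sym_ev \<psi> (bracket_minor d u v) \<noteq> 0"
    by (rule nonzero_bracket_minor)
  moreover have "ideal_gen {sym_incl vir_z - sym_const (\<chi> vir_z)} \<subseteq> poisson_core \<psi>"
    using central_ideal_subset_poisson_core [OF \<psi>(1)] by (simp add: \<psi>(2) z)
  ultimately have "bracket_minor d u v \<in> poisson_core \<psi>" using sub minor by blast
  then show False using \<psi>(3) poisson_core_sym_ev by blast
qed

section \<open>The equivalence\<close>

theorem theorem1p1:
  fixes \<chi> :: "vir \<Rightarrow> complex"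
  assumes "\<chi> \<in> vir_dual"
  shows "(ideal_gen {sym_incl vir_z - sym_const (\<chi> vir_z)} \<subset> poisson_core \<chi> \<longleftrightarrow>
            \<chi> vir_z = 0 \<and> combination_of_local_functionals (witt_functional \<chi>)) \<and>
         (\<chi> vir_z = 0 \<and> combination_of_local_functionals (witt_functional \<chi>) \<longleftrightarrow>
            vir_finite_codim (isotropy \<chi>))"
proof -
  let ?core = "ideal_gen {sym_incl vir_z - sym_const (\<chi> vir_z)} \<subset> poisson_core \<chi>"
  let ?local = "\<chi> vir_z = 0 \<and> combination_of_local_functionals (witt_functional \<chi>)"
  have core: "?core \<longleftrightarrow> \<not> poisson_core \<chi> \<subseteq> ideal_gen {sym_incl vir_z - sym_const (\<chi> vir_z)}"
    using central_ideal_subset_poisson_core [OF assms] by blast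
  have local: "?local" if "unbounded_isotropy \<chi>"
    using unbounded_isotropy_annihilator [OF assms that]
      combination_if_annihilated [OF linear_form_witt_functional [OF assms]] by blast
  have "?local" if ?core
    using that local poisson_core_unbounded_isotropy [OF assms] core by blast
  moreover have "vir_finite_codim (isotropy \<chi>)" if ?local
    using that combination_annihilator annihilator_finite_codim [OF assms] by blast
  moreover have "?local" if "vir_finite_codim (isotropy \<chi>)"
    using local finite_codim_unbounded_isotropy [OF assms that] .
  moreover have ?core if ?local "vir_finite_codim (isotropy \<chi>)"
    unfolding core using finite_codim_poisson_core [OF assms] that by blast
  ultimately show ?thesis by blast
qed

end
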